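(* Let $\Omega=(0,1)\times(0,1)$, let $h:[0,1]\to\mathbb{R}$ be a bounded function with $h(0)=0$, $h(x_1)>0$ for $x_1\in(0,1]$, $h\in C^1(0,1]$, satisfying, for some constants $C>0$ and $\theta\in(0,1)$, $$\sup_{x\in\Omega,\ 0<r\le d}\frac{\int_{B(x,r)\cap\Omega}h(x_1)^{-1}\,dx}{|B(x,r)\cap\Omega|^{\theta}}\le C$$ ($d$ the diameter of $\Omega$), and let $V\in L^\infty(\Omega)$ with $m\le V\le M$ a.e., where $m,M$ are nonnegative constants. Then for every $f\in L^2(\Omega)$ the problem $$-\big(\partial_{x_1x_1}u+h(x_1)\partial_{x_2x_2}u\big)+Vu=f\ \text{in }\Omega,\qquad u=0\ \text{on }\partial\Omega$$ has a unique weak solution $u\in\mathcal{H}_{h,0}^1(\Omega)$.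
   Context: $\mathcal{H}_h^1(\Omega)=\{u\in L^2(\Omega)\mid \partial_{x_1}u\in L^2(\Omega),\ \sqrt{h(x_1)}\,\partial_{x_2}u\in L^2(\Omega)\}$ with norm $\big(\|u\|_{L^2}^2+\|\partial_{x_1}u\|_{L^2}^2+\|\sqrt{h(x_1)}\partial_{x_2}u\|_{L^2}^2\big)^{1/2}$; $\mathcal{H}_{h,0}^1(\Omega)$ is the closure of $C_0^\infty(\Omega)$ in it. The bilinear form is $B[u,v]=\int_\Omega \partial_{x_1}u\,\partial_{x_1}v+h(x_1)\partial_{x_2}u\,\partial_{x_2}v+Vuv\,dx$ for $u,v\in\mathcal{H}_{h,0}^1(\Omega)$. A weak solution is $u\in\mathcal{H}_{h,0}^1(\Omega)$ with $B[u,v]=(f,v)_{L^2(\Omega)}$ for all $v\in\mathcal{H}_{h,0}^1(\Omega)$. *)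

theory Defs
  imports "HOL-Analysis.Analysis"
begin

definition Omega :: "(real \<times> real) set" where
  "Omega = {0<..<1} \<times> {0<..<1}"

definition pd1 :: "(real \<times> real \<Rightarrow> real) \<Rightarrow> real \<times> real \<Rightarrow> real" where
  "pd1 \<phi> = (\<lambda>(a, b). deriv (\<lambda>t. \<phi> (t, b)) a)"

definition pd2 :: "(real \<times> real \<Rightarrow> real) \<Rightarrow> real \<times> real \<Rightarrow> real" where
  "pd2 \<phi> = (\<lambda>(a, b). deriv (\<lambda>t. \<phi> (a, t)) b)"

fun iter_pd :: "bool list \<Rightarrow> (real \<times> real \<Rightarrow> real) \<Rightarrow> real \<times> real \<Rightarrow> real" where
  "iter_pd [] \<phi> = \<phi>"
| "iter_pd (b # bs) \<phi> = (if b then pd1 else pd2) (iter_pd bs \<phi>)"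

definition smooth2 :: "(real \<times> real \<Rightarrow> real) \<Rightarrow> bool" where
  "smooth2 \<phi> \<longleftrightarrow> (\<forall>bs x. iter_pd bs \<phi> differentiable (at x))"

definition test_fun :: "(real \<times> real \<Rightarrow> real) \<Rightarrow> bool" where
  "test_fun \<phi> \<longleftrightarrow> smooth2 \<phi> \<and> compact (closure {x. \<phi> x \<noteq> 0})
                     \<and> closure {x. \<phi> x \<noteq> 0} \<subseteq> Omega"

abbreviation LOm :: "(real \<times> real) measure" where
  "LOm \<equiv> lebesgue_on Omega"

definition L2 :: "(real \<times> real \<Rightarrow> real) \<Rightarrow> bool" where
  "L2 u \<longleftrightarrow> u \<in> borel_measurable LOm \<and> integrable LOm (\<lambda>x. (u x)\<^sup>2)"

definition loc_integrable :: "(real \<times> real \<Rightarrow> real) \<Rightarrow> bool" where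
  "loc_integrable g \<longleftrightarrow> (\<forall>K. compact K \<and> K \<subseteq> Omega \<longrightarrow> integrable (lebesgue_on K) g)"

definition is_wd1 :: "(real \<times> real \<Rightarrow> real) \<Rightarrow> (real \<times> real \<Rightarrow> real) \<Rightarrow> bool" where
  "is_wd1 u g \<longleftrightarrow> loc_integrable u \<and> loc_integrable g \<and>
     (\<forall>\<phi>. test_fun \<phi> \<longrightarrow>
        (\<integral>x. u x * pd1 \<phi> x \<partial>LOm) = - (\<integral>x. g x * \<phi> x \<partial>LOm))"

definition is_wd2 :: "(real \<times> real \<Rightarrow> real) \<Rightarrow> (real \<times> real \<Rightarrow> real) \<Rightarrow> bool" where
  "is_wd2 u g \<longleftrightarrow> loc_integrable u \<and> loc_integrable g \<and>
     (\<forall>\<phi>. test_fun \<phi> \<longrightarrow>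
        (\<integral>x. u x * pd2 \<phi> x \<partial>LOm) = - (\<integral>x. g x * \<phi> x \<partial>LOm))"

text \<open>The weak derivatives (unique up to a.e. equality, chosen by Hilbert choice).\<close>
definition wd1 :: "(real \<times> real \<Rightarrow> real) \<Rightarrow> real \<times> real \<Rightarrow> real" where
  "wd1 u = (SOME g. is_wd1 u g)"

definition wd2 :: "(real \<times> real \<Rightarrow> real) \<Rightarrow> real \<times> real \<Rightarrow> real" where
  "wd2 u = (SOME g. is_wd2 u g)"

definition H1h :: "(real \<Rightarrow> real) \<Rightarrow> (real \<times> real \<Rightarrow> real) \<Rightarrow> bool" where
  "H1h h u \<longleftrightarrow> L2 u \<and> (\<exists>g. is_wd1 u g) \<and> (\<exists>g. is_wd2 u g) \<and>
     L2 (wd1 u) \<and> L2 (\<lambda>x. sqrt (h (fst x)) * wd2 u x)"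

definition H1h_norm :: "(real \<Rightarrow> real) \<Rightarrow> (real \<times> real \<Rightarrow> real) \<Rightarrow> real" where
  "H1h_norm h u = sqrt ((\<integral>x. (u x)\<^sup>2 \<partial>LOm) + (\<integral>x. (wd1 u x)\<^sup>2 \<partial>LOm)
                       + (\<integral>x. (sqrt (h (fst x)) * wd2 u x)\<^sup>2 \<partial>LOm))"

definition H1h0 :: "(real \<Rightarrow> real) \<Rightarrow> (real \<times> real \<Rightarrow> real) \<Rightarrow> bool" where
  "H1h0 h u \<longleftrightarrow> H1h h u \<and>
     (\<exists>\<phi> :: nat \<Rightarrow> real \<times> real \<Rightarrow> real. (\<forall>n. test_fun (\<phi> n)) \<and>
        (\<lambda>n. H1h_norm h (\<lambda>x. u x - \<phi> n x)) \<longlonglongrightarrow> 0)"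

definition bilin :: "(real \<Rightarrow> real) \<Rightarrow> (real \<times> real \<Rightarrow> real) \<Rightarrow>
    (real \<times> real \<Rightarrow> real) \<Rightarrow> (real \<times> real \<Rightarrow> real) \<Rightarrow> real" where
  "bilin h V u v = (\<integral>x. wd1 u x * wd1 v x + h (fst x) * wd2 u x * wd2 v x + V x * u x * v x \<partial>LOm)"

definition weak_solution :: "(real \<Rightarrow> real) \<Rightarrow> (real \<times> real \<Rightarrow> real) \<Rightarrow>
    (real \<times> real \<Rightarrow> real) \<Rightarrow> (real \<times> real \<Rightarrow> real) \<Rightarrow> bool" where
  "weak_solution h V f u \<longleftrightarrow> H1h0 h u \<and>
     (\<forall>v. H1h0 h v \<longrightarrow> bilin h V u v = (\<integral>x. f x * v x \<partial>LOm))"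

end

theory Submission
  imports Defs
begin

text \<open>
  The energy \<open>B[v,v] - 2(f,v)\<close> is bounded below on test functions, because the Poincare inequality
  in the nondegenerate direction \<open>x\<^sub>1\<close> controls \<open>\<parallel>v\<parallel>\<close> by \<open>\<parallel>\<partial>\<^sub>1v\<parallel>\<close>. By the parallelogram
  identity a minimizing sequence is Cauchy in energy, so \<open>v\<^sub>n\<close>, \<open>\<partial>\<^sub>1v\<^sub>n\<close> and \<open>\<surd>h \<partial>\<^sub>2v\<^sub>n\<close> converge in
  \<open>L\<^sup>2\<close>; as \<open>h\<close> is bounded away from 0 on compact subsets of the square, the limits are weak
  derivatives and the Euler-Lagrange equation passes to the limit. Uniqueness is the Poincare
  inequality again. Weak derivatives are well defined because test functions approximate
  indicators of boxes.
\<close>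

section \<open>Square-integrable functions\<close>

text \<open>\<open>wd1\<close> and \<open>wd2\<close> are picked by Hilbert choice, so linearity can
  be expected of them only almost everywhere, and functions that agree a.e. are not identified:
  \<open>H1h0\<close> is not literally a Hilbert space to which Lax-Milgram could be applied. The
  minimization therefore runs over test functions, where \<open>pd1\<close> and \<open>pd2\<close>
  are honest linear operators, and completeness is needed only for three separate sequences in
  \<open>L2\<close>. Their limits travel as a triple (u, p, q), with q in the role of
  \<open>sqrt h * wd2 u\<close>; membership in \<open>H1h0\<close> and the form \<open>bilin\<close>
  are translated to and from such triples (\<open>H_limit\<close>, \<open>energy\<close>). Since h
  vanishes at 0, the candidate q / sqrt h for the second weak derivative need not be square
  integrable on the whole square; it is only locally integrable. This is why uniqueness of weak
  derivatives has to be proved for locally integrable functions, and why the derivative in x2 is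
  tested against psi / sqrt h, with psi a test function.\<close>

definition square_integrable :: "'a measure \<Rightarrow> ('a \<Rightarrow> real) \<Rightarrow> bool" where
  "square_integrable M u \<longleftrightarrow> u \<in> borel_measurable M \<and> integrable M (\<lambda>x. (u x)\<^sup>2)"

lemma square_integrable_power2: "square_integrable M u \<Longrightarrow> integrable M (\<lambda>x. (u x)\<^sup>2)"
  by (simp add: square_integrable_def)

lemma square_integrable_mult:
  assumes "square_integrable M u" "square_integrable M v"
  shows "integrable M (\<lambda>x. u x * v x)"
proof (rule Bochner_Integration.integrable_bound)
  show "integrable M (\<lambda>x. (u x)\<^sup>2 + (v x)\<^sup>2)"
    using assms by (simp add: square_integrable_def)
  show "(\<lambda>x. u x * v x) \<in> borel_measurable M"
    using assms by (auto simp: square_integrable_def)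
  have "\<bar>a * b\<bar> \<le> \<bar>a\<^sup>2 + b\<^sup>2\<bar>" for a b :: real
  proof -
    have "2 * (\<bar>a\<bar> * \<bar>b\<bar>) \<le> a\<^sup>2 + b\<^sup>2" "0 \<le> \<bar>a\<bar> * \<bar>b\<bar>"
      using sum_squares_bound[of "\<bar>a\<bar>" "\<bar>b\<bar>"] by simp_all
    then show ?thesis unfolding abs_mult by linarith
  qed
  then show "AE x in M. norm (u x * v x) \<le> norm ((u x)\<^sup>2 + (v x)\<^sup>2)"
    by simp
qed

lemma square_integrable_bound_mult:
  assumes "square_integrable M u" "b \<in> borel_measurable M" "AE x in M. \<bar>b x\<bar> \<le> K"
  shows "square_integrable M (\<lambda>x. b x * u x)"
  unfolding square_integrable_def
proof
  show "(\<lambda>x. b x * u x) \<in> borel_measurable M"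
    using assms by (auto simp: square_integrable_def)
  show "integrable M (\<lambda>x. (b x * u x)\<^sup>2)"
  proof (rule Bochner_Integration.integrable_bound)
    show "integrable M (\<lambda>x. K\<^sup>2 * (u x)\<^sup>2)"
      using assms by (simp add: square_integrable_def)
    show "(\<lambda>x. (b x * u x)\<^sup>2) \<in> borel_measurable M"
      using assms by (auto simp: square_integrable_def)
    show "AE x in M. norm ((b x * u x)\<^sup>2) \<le> norm (K\<^sup>2 * (u x)\<^sup>2)"
      using assms(3) by eventually_elim
        (auto simp: power_mult_distrib abs_le_square_iff[symmetric] intro!: mult_right_mono)
  qed
qed

lemma square_integrable_cmult:
  "square_integrable M u \<Longrightarrow> square_integrable M (\<lambda>x. c * u x)"
  by (rule square_integrable_bound_mult[where K = "\<bar>c\<bar>"]) auto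

lemma square_integrable_add:
  assumes "square_integrable M u" "square_integrable M v"
  shows "square_integrable M (\<lambda>x. u x + v x)"
  using assms square_integrable_mult[OF assms]
  by (auto simp: square_integrable_def power2_sum mult.assoc)

lemma square_integrable_diff:
  assumes "square_integrable M u" "square_integrable M v"
  shows "square_integrable M (\<lambda>x. u x - v x)"
  using assms square_integrable_mult[OF assms]
  by (auto simp: square_integrable_def power2_diff mult.assoc)

lemma (in finite_measure) square_integrable_bounded:
  assumes "u \<in> borel_measurable M" "AE x in M. \<bar>u x\<bar> \<le> K"
  shows "square_integrable M u"
  using square_integrable_bound_mult[of M "\<lambda>_. 1" u K] assms
  by (simp add: square_integrable_def)

lemma (in finite_measure) square_integrable_integrable:
  assumes "square_integrable M u"
  shows "integrable M u"
  using square_integrable_mult[OF assms square_integrable_bounded[of "\<lambda>_. 1" 1]] by simp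

text \<open>The quadratic polynomial t -> integral of (u + t v)^2 is nonnegative; evaluating it at
  one well-chosen t gives the discriminant inequality.\<close>

lemma square_integrable_Cauchy_Schwarz:
  assumes u: "square_integrable M u" and v: "square_integrable M v"
  shows "(\<integral>x. u x * v x \<partial>M)\<^sup>2 \<le> (\<integral>x. (u x)\<^sup>2 \<partial>M) * (\<integral>x. (v x)\<^sup>2 \<partial>M)"
proof -
  let ?A = "\<integral>x. (u x)\<^sup>2 \<partial>M" and ?B = "\<integral>x. u x * v x \<partial>M" and ?C = "\<integral>x. (v x)\<^sup>2 \<partial>M"
  have quad: "0 \<le> ?A + 2 * t * ?B + t\<^sup>2 * ?C" for t
  proof -
    have "0 \<le> (\<integral>x. (u x + t * v x)\<^sup>2 \<partial>M)" by simp
    also have "\<dots> = (\<integral>x. (u x)\<^sup>2 + (2 * t) * (u x * v x) + t\<^sup>2 * (v x)\<^sup>2 \<partial>M)"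
      by (rule arg_cong[where f = "integral\<^sup>L M"]) (auto simp: power2_eq_square algebra_simps)
    also have "\<dots> = ?A + 2 * t * ?B + t\<^sup>2 * ?C"
      using square_integrable_mult[OF u v] square_integrable_power2[OF u]
        square_integrable_power2[OF v] by simp
    finally show ?thesis .
  qed
  have C: "0 \<le> ?C" and A: "0 \<le> ?A" by simp_all
  show ?thesis
  proof (cases "?C = 0")
    case False
    with C have "?C > 0" by linarith
    \<comment> \<open>The minimizer of the quadratic.\<close>
    with quad[of "- ?B / ?C"] show ?thesis
      by (simp add: field_simps power2_eq_square)
  next
    case True
    have "?B = 0"
    proof (rule ccontr)
      assume "?B \<noteq> 0"
      \<comment> \<open>With \<open>?C = 0\<close> the polynomial is affine in t; this t gives it
        the value - \<open>?A\<close> - 2, which is negative.\<close>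
      with quad[of "- (?A + 1) / ?B"] True A show False by simp
    qed
    with True show ?thesis by simp
  qed
qed

text \<open>Strong convergence implies weak convergence, by Cauchy-Schwarz. All limits are stated
  for squared norms, so that no square roots have to be carried along.\<close>

lemma tendsto_integral_mult_L2:
  assumes a: "\<And>n. square_integrable M (a n)" "square_integrable M a'"
    and b: "square_integrable M b"
    and lim: "(\<lambda>n. \<integral>x. (a' x - a n x)\<^sup>2 \<partial>M) \<longlonglongrightarrow> 0"
  shows "(\<lambda>n. \<integral>x. a n x * b x \<partial>M) \<longlonglongrightarrow> (\<integral>x. a' x * b x \<partial>M)"
proof -
  have eq: "(\<integral>x. (a' x - a n x) * b x \<partial>M) = (\<integral>x. a' x * b x \<partial>M) - (\<integral>x. a n x * b x \<partial>M)" for n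
    using square_integrable_mult[OF a(1)[of n] b] square_integrable_mult[OF a(2) b]
    by (simp add: left_diff_distrib)
  have "(\<lambda>n. (\<integral>x. (a' x - a n x)\<^sup>2 \<partial>M) * (\<integral>x. (b x)\<^sup>2 \<partial>M)) \<longlonglongrightarrow> 0"
    using tendsto_mult_right[OF lim] by simp
  then have "(\<lambda>n. (\<integral>x. (a' x - a n x) * b x \<partial>M)\<^sup>2) \<longlonglongrightarrow> 0"
    by (rule tendsto_sandwich[OF _ _ tendsto_const, rotated 2])
      (auto intro!: always_eventually square_integrable_Cauchy_Schwarz square_integrable_diff a b)
  then have "(\<lambda>n. (\<integral>x. a' x * b x \<partial>M) - (\<integral>x. a n x * b x \<partial>M)) \<longlonglongrightarrow> 0"
    unfolding eq by simp
  then show ?thesis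
    using tendsto_diff[OF tendsto_const[of "\<integral>x. a' x * b x \<partial>M"]] by fastforce
qed

section \<open>Completeness of L2 over a finite measure\<close>

text \<open>Cauchy-Schwarz against the constant 1 turns the rate (1/4)^n for squared norms into K
  (1/2)^n for the L1 norms of the increments. Their sum is finite, so the increments are absolutely
  summable at almost every point and the sequence telescopes to a limit.\<close>

lemma (in finite_measure) L2_complete_fast:
  fixes v :: "nat \<Rightarrow> 'a \<Rightarrow> real"
  assumes v: "\<And>n. square_integrable M (v n)"
    and fast: "\<And>n. (\<integral>x. (v (Suc n) x - v n x)\<^sup>2 \<partial>M) \<le> (1/4) ^ n"
  shows "\<exists>w\<in>borel_measurable M. AE x in M. (\<lambda>n. v n x) \<longlonglongrightarrow> w x"
proof -
  define D where "D n x = v (Suc n) x - v n x" for n x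
  have D: "square_integrable M (D n)" for n
    unfolding D_def using v by (intro square_integrable_diff)
  have [measurable]: "D n \<in> borel_measurable M" for n
    using D[of n] by (simp add: square_integrable_def)
  have Dint: "integrable M (\<lambda>x. \<bar>D n x\<bar>)" for n
    using square_integrable_integrable[OF D] by simp
  define K where "K = sqrt (measure M (space M))"
  have one: "(\<integral>x. \<bar>D n x\<bar> \<partial>M) \<le> K * (1/2) ^ n" for n
  proof -
    have absD: "square_integrable M (\<lambda>x. \<bar>D n x\<bar>)"
      using D[of n] by (auto simp: square_integrable_def)
    have "(\<integral>x. \<bar>D n x\<bar> * 1 \<partial>M)\<^sup>2 \<le> (\<integral>x. (\<bar>D n x\<bar>)\<^sup>2 \<partial>M) * (\<integral>x. 1\<^sup>2 \<partial>M)"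
      by (rule square_integrable_Cauchy_Schwarz[OF absD]) (simp add: square_integrable_def)
    also have "\<dots> \<le> (1/4) ^ n * measure M (space M)"
      using fast[of n] by (simp add: D_def mult_right_mono)
    also have "\<dots> = (K * (1/2) ^ n)\<^sup>2"
    proof -
      have "((1/2) ^ n)\<^sup>2 = ((1/2)\<^sup>2 :: real) ^ n" by (metis power_mult mult.commute)
      then have "((1/2) ^ n)\<^sup>2 = ((1/4) ^ n :: real)" by (simp add: power2_eq_square)
      moreover have "K\<^sup>2 = measure M (space M)" by (simp add: K_def)
      ultimately show ?thesis unfolding power_mult_distrib by (simp only: mult.commute)
    qed
    finally have "(\<integral>x. \<bar>D n x\<bar> \<partial>M)\<^sup>2 \<le> (K * (1/2) ^ n)\<^sup>2" by simp
    then show ?thesis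
      by (rule power2_le_imp_le) (simp add: K_def)
  qed
  have "AE x in M. summable (\<lambda>n. \<bar>D n x\<bar>)"
  proof -
    have "(\<integral>\<^sup>+ x. (\<Sum>n. ennreal \<bar>D n x\<bar>) \<partial>M) = (\<Sum>n. \<integral>\<^sup>+ x. ennreal \<bar>D n x\<bar> \<partial>M)"
      by (intro nn_integral_suminf) auto
    also have "\<dots> = (\<Sum>n. ennreal (\<integral>x. \<bar>D n x\<bar> \<partial>M))"
      using Dint by (intro suminf_cong nn_integral_eq_integral) auto
    also have "\<dots> \<le> (\<Sum>n. ennreal (K * (1/2) ^ n))"
      using one by (intro suminf_le summableI ennreal_leI)
    also have "\<dots> = ennreal (\<Sum>n. K * (1/2) ^ n)"
      by (rule suminf_ennreal2) (auto simp: K_def intro!: summable_mult summable_geometric)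
    finally have "(\<integral>\<^sup>+ x. (\<Sum>n. ennreal \<bar>D n x\<bar>) \<partial>M) \<noteq> \<infinity>"
      by (auto simp: top_unique)
    moreover have "(\<lambda>x. \<Sum>n. ennreal \<bar>D n x\<bar>) \<in> borel_measurable M"
      by measurable
    ultimately have "AE x in M. (\<Sum>n. ennreal \<bar>D n x\<bar>) \<noteq> \<infinity>"
      by (intro nn_integral_PInf_AE)
    then show ?thesis
      by eventually_elim (auto intro: summable_suminf_not_top)
  qed
  then have conv: "AE x in M. convergent (\<lambda>n. v n x)"
  proof eventually_elim
    case (elim x)
    then have "summable (\<lambda>n. D n x)" by (rule summable_rabs_cancel)
    then have "convergent (\<lambda>n. \<Sum>k<n. D k x)" by (simp add: summable_iff_convergent)
    moreover have "(\<Sum>k<n. D k x) = v n x - v 0 x" for n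
      unfolding D_def by (rule sum_lessThan_telescope)
    ultimately have "convergent (\<lambda>n. v n x - v 0 x)" by simp
    then show ?case
      using convergent_add[OF _ convergent_const[of "v 0 x"]] by fastforce
  qed
  show ?thesis
  proof (intro bexI[where x = "\<lambda>x. lim (\<lambda>n. v n x)"])
    show "(\<lambda>x. lim (\<lambda>n. v n x)) \<in> borel_measurable M"
      using v by (intro borel_measurable_lim_metric) (auto simp: square_integrable_def)
    show "AE x in M. (\<lambda>n. v n x) \<longlonglongrightarrow> lim (\<lambda>n. v n x)"
      using conv by eventually_elim (simp add: convergent_LIMSEQ_iff)
  qed
qed

text \<open>A fast subsequence supplies the pointwise limit \<open>w\<close>. Fatou's lemma along
  that subsequence carries a Cauchy bound on v m - v n over to w - v n, so the whole sequence
  converges in the mean.\<close>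

lemma (in finite_measure) L2_complete:
  fixes v :: "nat \<Rightarrow> 'a \<Rightarrow> real"
  assumes v: "\<And>n. square_integrable M (v n)"
    and cauchy: "\<And>e. e > 0 \<Longrightarrow> \<exists>N. \<forall>m\<ge>N. \<forall>n\<ge>N. (\<integral>x. (v m x - v n x)\<^sup>2 \<partial>M) \<le> e"
  shows "\<exists>w. square_integrable M w \<and> (\<lambda>n. \<integral>x. (w x - v n x)\<^sup>2 \<partial>M) \<longlonglongrightarrow> 0"
proof -
  have "\<exists>N. \<forall>m\<ge>N. \<forall>n\<ge>N. (\<integral>x. (v m x - v n x)\<^sup>2 \<partial>M) \<le> (1/4) ^ k" for k :: nat
    by (rule cauchy) simp
  then obtain N where N: "\<And>k m n. m \<ge> N k \<Longrightarrow> n \<ge> N k \<Longrightarrow>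
      (\<integral>x. (v m x - v n x)\<^sup>2 \<partial>M) \<le> (1/4) ^ k"
    by metis
  \<comment> \<open>An explicit choice that exceeds \<open>N k\<close>, is monotone, so that
    \<open>s (Suc k)\<close> also exceeds \<open>N k\<close>, and is at least \<open>k\<close>, so
    that the subsequence eventually passes any index, as Fatou requires.\<close>
  define s where "s k = k + (\<Sum>j\<le>k. N j)" for k
  have sN: "s k \<ge> N k" for k
    unfolding s_def by (metis atMost_iff finite_atMost le_add2 member_le_sum order.refl order_trans zero_le)
  have smono: "s k \<le> s (Suc k)" for k by (simp add: s_def)
  have sk: "s k \<ge> k" for k by (simp add: s_def)
  obtain w where w: "w \<in> borel_measurable M" "AE x in M. (\<lambda>n. v (s n) x) \<longlonglongrightarrow> w x"
    using L2_complete_fast[of "\<lambda>n. v (s n)"] v N[OF order_trans[OF sN smono] sN] by auto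
  have fatou: "integrable M (\<lambda>x. (w x - v n x)\<^sup>2) \<and> (\<integral>x. (w x - v n x)\<^sup>2 \<partial>M) \<le> e"
    if e: "e \<ge> 0" "\<And>m. m \<ge> n \<Longrightarrow> (\<integral>x. (v m x - v n x)\<^sup>2 \<partial>M) \<le> e" for e n
  proof -
    have sq: "square_integrable M (\<lambda>x. v m x - v n x)" for m
      using v by (intro square_integrable_diff)
    have meas: "(\<lambda>x. w x - v n x) \<in> borel_measurable M"
      using w(1) v[of n] by (auto simp: square_integrable_def)
    have "(\<integral>\<^sup>+x. ennreal ((w x - v n x)\<^sup>2) \<partial>M)
        = (\<integral>\<^sup>+x. liminf (\<lambda>k. ennreal ((v (s k) x - v n x)\<^sup>2)) \<partial>M)"
    proof (rule nn_integral_cong_AE, use w(2) in eventually_elim)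
      case (elim x)
      then have "(\<lambda>k. ennreal ((v (s k) x - v n x)\<^sup>2)) \<longlonglongrightarrow> ennreal ((w x - v n x)\<^sup>2)"
        by (intro tendsto_intros tendsto_ennrealI)
      then show ?case by (rule lim_imp_Liminf[OF sequentially_bot, symmetric])
    qed
    also have "\<dots> \<le> liminf (\<lambda>k. \<integral>\<^sup>+x. ennreal ((v (s k) x - v n x)\<^sup>2) \<partial>M)"
      using sq by (intro nn_integral_liminf) (auto simp: square_integrable_def)
    also have "\<dots> = liminf (\<lambda>k. ennreal (\<integral>x. (v (s k) x - v n x)\<^sup>2 \<partial>M))"
      using sq by (subst nn_integral_eq_integral) (auto simp: square_integrable_def)
    also have "\<dots> \<le> ennreal e"
    proof (rule Liminf_le)
      show "\<forall>\<^sub>F k in sequentially. ennreal (\<integral>x. (v (s k) x - v n x)\<^sup>2 \<partial>M) \<le> ennreal e"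
        using eventually_ge_at_top[of n]
        by eventually_elim (intro ennreal_leI e(2) order_trans[OF _ sk])
    qed simp
    finally have le: "(\<integral>\<^sup>+x. ennreal ((w x - v n x)\<^sup>2) \<partial>M) \<le> ennreal e" .
    have int: "integrable M (\<lambda>x. (w x - v n x)\<^sup>2)"
      using meas le by (intro integrableI_bounded) (auto simp: top_unique less_top[symmetric])
    then show ?thesis
      using le e(1) by (simp add: nn_integral_eq_integral)
  qed
  have conv: "\<exists>N. \<forall>n\<ge>N. integrable M (\<lambda>x. (w x - v n x)\<^sup>2) \<and> (\<integral>x. (w x - v n x)\<^sup>2 \<partial>M) \<le> e"
    if "e > 0" for e
    using cauchy[OF that] fatou[of e] that by (meson less_imp_le order_trans)
  obtain n where n: "integrable M (\<lambda>x. (w x - v n x)\<^sup>2)" using conv[of 1] by auto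
  \<comment> \<open>Fatou controls only differences; \<open>w\<close> itself is recovered by adding
    one \<open>v n\<close> back.\<close>
  have "square_integrable M (\<lambda>x. (w x - v n x) + v n x)"
    using n v[of n] w(1) by (intro square_integrable_add) (auto simp: square_integrable_def)
  moreover have "(\<lambda>n. \<integral>x. (w x - v n x)\<^sup>2 \<partial>M) \<longlonglongrightarrow> 0"
  proof (rule LIMSEQ_I)
    fix r :: real assume "r > 0"
    then obtain N where "\<forall>n\<ge>N. (\<integral>x. (w x - v n x)\<^sup>2 \<partial>M) \<le> r / 2"
      using conv[of "r / 2"] by auto
    with \<open>r > 0\<close> show "\<exists>N. \<forall>n\<ge>N. norm ((\<integral>x. (w x - v n x)\<^sup>2 \<partial>M) - 0) < r"
      by (intro exI[of _ N]) (auto intro: le_less_trans)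
  qed
  ultimately show ?thesis by auto
qed

section \<open>Minimizing sequences of quadratic functionals\<close>

text \<open>A Riesz representation without completeness: the minimizer of J(u) = B u u - 2 F u may
  lie outside \<open>T\<close>, so the result is a Cauchy minimizing sequence along which the
  Euler-Lagrange equation holds in the limit. \<open>B\<close> may be only semidefinite; the bound
  on F^2 by \<open>B\<close> replaces coercivity. Closure under u + c v covers sums, multiples and
  differences at once.\<close>

lemma Riesz_minimizing_sequence:
  fixes T :: "('a \<Rightarrow> real) set" and B :: "('a \<Rightarrow> real) \<Rightarrow> ('a \<Rightarrow> real) \<Rightarrow> real"
  assumes T0: "T \<noteq> {}"
    and T: "\<And>u v c. u \<in> T \<Longrightarrow> v \<in> T \<Longrightarrow> (\<lambda>x. u x + c * v x) \<in> T"
    and B_lin: "\<And>u v w c. u \<in> T \<Longrightarrow> v \<in> T \<Longrightarrow> w \<in> T \<Longrightarrow> B (\<lambda>x. u x + c * v x) w = B u w + c * B v w"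
    and B_sym: "\<And>u v. u \<in> T \<Longrightarrow> v \<in> T \<Longrightarrow> B u v = B v u"
    and B_pos: "\<And>u. u \<in> T \<Longrightarrow> 0 \<le> B u u"
    and F_lin: "\<And>u v c. u \<in> T \<Longrightarrow> v \<in> T \<Longrightarrow> F (\<lambda>x. u x + c * v x) = F u + c * F v"
    and F_bdd: "\<And>u. u \<in> T \<Longrightarrow> (F u)\<^sup>2 \<le> K * B u u"
  obtains v where "\<And>n. v n \<in> T"
    and "\<And>m n. B (\<lambda>x. v m x - v n x) (\<lambda>x. v m x - v n x) \<le> 2 / Suc m + 2 / Suc n"
    and "\<And>w. w \<in> T \<Longrightarrow> (\<lambda>n. B (v n) w) \<longlonglongrightarrow> F w"
proof -
  define J where "J u = B u u - 2 * F u" for u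
  have exp: "B (\<lambda>x. u x + c * v x) (\<lambda>x. u x + c * v x) = B u u + 2 * c * B u v + c\<^sup>2 * B v v"
    if "u \<in> T" "v \<in> T" for u v c
    using that by (simp add: B_lin T B_sym[of _ "\<lambda>x. u x + c * v x"] B_sym[of v u]
        power2_eq_square algebra_simps)
  \<comment> \<open>Arithmetic-geometric mean inequality; it yields the lower bound -|K| for
    \<open>J\<close>.\<close>
  have K: "F u \<le> (B u u + \<bar>K\<bar>) / 2" if "u \<in> T" for u
  proof -
    have "(F u)\<^sup>2 \<le> \<bar>K\<bar> * B u u"
      using F_bdd[OF that] B_pos[OF that] by (smt (verit) mult_right_mono)
    also have "\<dots> \<le> ((B u u + \<bar>K\<bar>) / 2)\<^sup>2"
      using sum_squares_bound[of "B u u" "\<bar>K\<bar>"] by (simp add: power2_eq_square field_simps)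
    finally show ?thesis
      by (rule power2_le_imp_le) (use B_pos[OF that] in simp)
  qed
  have J_ge: "J u \<ge> - \<bar>K\<bar>" if "u \<in> T" for u
    using K[OF that] by (simp add: J_def)
  then have bdd: "bdd_below (J ` T)" by (auto intro!: bdd_belowI)
  define I where "I = Inf (J ` T)"
  have I_le: "I \<le> J u" if "u \<in> T" for u
    unfolding I_def using that bdd by (intro cInf_lower) auto
  have "\<exists>u\<in>T. J u < I + 1 / Suc n" for n
    using cInf_lessD[of "J ` T" "I + 1 / Suc n"] T0 by (force simp: I_def)
  then obtain v where v: "\<And>n. v n \<in> T" "\<And>n. J (v n) < I + 1 / Suc n" by metis
  have diffT: "(\<lambda>x. v m x - v n x) \<in> T" for m n
    using T[OF v(1) v(1), of m "-1" n] by simp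
  have par: "B (\<lambda>x. v m x - v n x) (\<lambda>x. v m x - v n x) \<le> 2 / Suc m + 2 / Suc n" for m n
  proof -
    \<comment> \<open>\<open>?z\<close> is the midpoint. The parallelogram identity reads J(v m) +
      J(v n) = 2 J(z) + B d d / 2, where J(z) is at least the infimum \<open>I\<close>.\<close>
    let ?z = "\<lambda>x. v n x + (1/2) * (v m x - v n x)" and ?d = "\<lambda>x. v m x - v n x"
    have "B ?z ?z = B (v n) (v n) + B (v n) ?d + B ?d ?d / 4"
      using exp[OF v(1) diffT, of n "1/2" m n] by (simp add: power2_eq_square)
    moreover have "F ?z = F (v n) + F ?d / 2"
      using F_lin[OF v(1) diffT, of n "1/2" m n] by simp
    moreover have "I \<le> J ?z" by (intro I_le T v diffT)
    moreover have "B (v m) (v m) = B (v n) (v n) + 2 * B (v n) ?d + B ?d ?d"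
      using exp[OF v(1) diffT, of n "1" m n] by simp
    moreover have "F (v m) = F (v n) + F ?d"
      using F_lin[OF v(1) diffT, of n 1 m n] by simp
    moreover note v(2)[of m] v(2)[of n]
    ultimately show ?thesis by (simp add: J_def)
  qed
  have "(\<lambda>n. B (v n) w) \<longlonglongrightarrow> F w" if w: "w \<in> T" for w
  proof -
    let ?b = "B w w"
    have b: "?b \<ge> 0" using B_pos[OF w] .
    have est: "(B (v n) w - F w)\<^sup>2 \<le> (?b + 1)\<^sup>2 * (1 / Suc n)" for n
    proof -
      let ?d = "B (v n) w - F w"
      \<comment> \<open>Nearly the best step in direction \<open>w\<close>. The denominator is
        \<open>?b + 1\<close> instead of \<open>?b\<close> because \<open>?b\<close> may be
        zero.\<close>
      define t where "t = - ?d / (?b + 1)"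
      have "I \<le> J (\<lambda>x. v n x + t * w x)" by (intro I_le T v w)
      also have "\<dots> = J (v n) + 2 * t * ?d + t\<^sup>2 * ?b"
        by (simp add: J_def exp v w F_lin algebra_simps)
      finally have "0 \<le> 1 / Suc n + 2 * t * ?d + t\<^sup>2 * ?b" using v(2)[of n] by simp
      also have "\<dots> \<le> 1 / Suc n + 2 * t * ?d + t\<^sup>2 * (?b + 1)" by (simp add: mult_left_mono)
      also have "\<dots> = 1 / Suc n - ?d\<^sup>2 / (?b + 1)"
      proof -
        have "2 * (- d / c) * d + (- d / c)\<^sup>2 * c = - (d\<^sup>2 / c)" if "c > 0" for c d :: real
          using that by (simp add: field_simps power2_eq_square)
        from this[of "?b + 1" ?d] b show ?thesis by (simp add: t_def)
      qed
      finally have "?d\<^sup>2 / (?b + 1) \<le> 1 / Suc n" by linarith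
      then have "?d\<^sup>2 \<le> (?b + 1) * (1 / Suc n)"
        using b by (subst (asm) pos_divide_le_eq) (linarith, simp only: mult.commute)
      also have "\<dots> \<le> (?b + 1)\<^sup>2 * (1 / Suc n)"
        using b by (intro mult_right_mono) (auto simp: power2_eq_square)
      finally show ?thesis .
    qed
    have "(\<lambda>n. (?b + 1)\<^sup>2 * (1 / Suc n)) \<longlonglongrightarrow> 0"
      using tendsto_mult_right_zero[OF LIMSEQ_Suc[OF lim_1_over_n]] by auto
    then have "(\<lambda>n. (B (v n) w - F w)\<^sup>2) \<longlonglongrightarrow> 0"
      by (rule tendsto_sandwich[OF _ _ tendsto_const, rotated 2])
        (intro always_eventually allI est zero_le_power2)+
    then show ?thesis
      by (simp add: LIM_zero_iff)
  qed
  with v(1) par show ?thesis by (rule that)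
qed

section \<open>Test functions on the unit square\<close>

lemma Omega_eq_box: "Omega = box (0, 0) (1, 1)"
  by (simp add: Omega_def box_prod box_real)

lemma Omega_lmeasurable [simp]: "Omega \<in> lmeasurable"
  by (simp add: Omega_eq_box)

lemma Omega_sets [measurable]: "Omega \<in> sets borel"
  by (simp add: Omega_eq_box)

lemma Omega_subset_cbox: "Omega \<subseteq> cbox (0, 0) (1, 1)"
  unfolding Omega_eq_box by (rule box_subset_cbox)

interpretation Omega: finite_measure LOm
  by (rule finite_measure_lebesgue_on) simp

lemma L2_iff: "L2 u \<longleftrightarrow> square_integrable LOm u"
  by (simp add: L2_def square_integrable_def)

lemma continuous_measurable_Omega:
  "continuous_on Omega f \<Longrightarrow> f \<in> borel_measurable LOm"
  by (intro continuous_imp_measurable_on_sets_lebesgue) (auto simp: fmeasurableD)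

lemma continuous_bounded_Omega:
  fixes f :: "real \<times> real \<Rightarrow> real"
  assumes "continuous_on UNIV f"
  obtains K where "\<And>x. x \<in> Omega \<Longrightarrow> \<bar>f x\<bar> \<le> K"
proof -
  have "bounded (f ` cbox (0, 0) (1, 1))"
    using assms by (intro compact_imp_bounded compact_continuous_image)
      (auto intro: continuous_on_subset)
  then obtain K where "\<forall>x\<in>cbox (0, 0) (1, 1). norm (f x) \<le> K"
    by (auto simp: bounded_iff)
  then show ?thesis using Omega_subset_cbox by (intro that[of K]) auto
qed

lemma AE_Omega: "(\<And>x. x \<in> Omega \<Longrightarrow> P x) \<Longrightarrow> AE x in LOm. P x"
  by (rule AE_I2) simp

lemma continuous_square_integrable_Omega:
  fixes f :: "real \<times> real \<Rightarrow> real"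
  assumes "continuous_on UNIV f"
  shows "square_integrable LOm f"
proof -
  obtain K where "\<And>x. x \<in> Omega \<Longrightarrow> \<bar>f x\<bar> \<le> K"
    using continuous_bounded_Omega[OF assms] by blast
  then show ?thesis
    using assms by (intro Omega.square_integrable_bounded[of f K] continuous_measurable_Omega AE_Omega)
      (auto intro: continuous_on_subset)
qed

section \<open>Fubini and integration of partial derivatives over the square\<close>

text \<open>Continuity on the whole plane makes \<open>D\<close> Borel, so the completed measure can
  be replaced by the product of two copies of \<open>lborel\<close>; integrability comes from the
  compact closed square. Both orders are stated because the inner variable must be the one that was
  differentiated.\<close>

lemma lebesgue_on_Omega_Fubini:
  fixes D :: "real \<times> real \<Rightarrow> real"
  assumes D: "continuous_on UNIV D"
  shows "(\<integral>z. D z \<partial>LOm) = (\<integral>x. \<integral>y. indicator Omega (x, y) * D (x, y) \<partial>lborel \<partial>lborel)"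
    and "(\<integral>z. D z \<partial>LOm) = (\<integral>y. \<integral>x. indicator Omega (x, y) * D (x, y) \<partial>lborel \<partial>lborel)"
proof -
  let ?D = "\<lambda>z. indicator Omega z * D z"
  have Dm [measurable]: "D \<in> borel_measurable borel"
    by (rule borel_measurable_continuous_onI[OF D])
  have "integrable lborel (\<lambda>z. indicator (cbox (0,0) (1,1)) z *\<^sub>R D z)"
    by (intro borel_integrable_compact) (auto intro: continuous_on_subset[OF D])
  then have "integrable lborel (\<lambda>z. indicator Omega z *\<^sub>R (indicator (cbox (0,0) (1,1)) z *\<^sub>R D z))"
    by (rule integrable_mult_indicator[rotated]) simp
  also have "(\<lambda>z. indicator Omega z *\<^sub>R (indicator (cbox (0,0) (1,1)) z *\<^sub>R D z)) = ?D"
    using Omega_subset_cbox by (auto simp: indicator_def fun_eq_iff)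
  finally have int: "integrable (lborel \<Otimes>\<^sub>M lborel) ?D"
    by (simp add: lborel_prod)
  have "(\<integral>z. D z \<partial>LOm) = (\<integral>z. ?D z \<partial>lebesgue)"
    by (subst integral_restrict_space) (auto simp: fmeasurableD)
  also have "\<dots> = (\<integral>z. ?D z \<partial>lborel)"
    by (rule integral_completion) measurable
  finally have eq: "(\<integral>z. D z \<partial>LOm) = integral\<^sup>L (lborel \<Otimes>\<^sub>M lborel) ?D"
    by (simp add: lborel_prod)
  show "(\<integral>z. D z \<partial>LOm) = (\<integral>x. \<integral>y. ?D (x, y) \<partial>lborel \<partial>lborel)"
    unfolding eq using lborel_pair.integral_fst'[OF int] by simp
  show "(\<integral>z. D z \<partial>LOm) = (\<integral>y. \<integral>x. ?D (x, y) \<partial>lborel \<partial>lborel)"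
    unfolding eq using lborel_pair.integral_snd[of "\<lambda>x y. ?D (x, y)"] int
    by (simp add: case_prod_beta')
qed

lemma integral_derivative_unit_interval:
  fixes F f :: "real \<Rightarrow> real"
  assumes "\<And>x. (F has_real_derivative f x) (at x)" "continuous_on UNIV f" "F 0 = 0" "F 1 = 0"
  shows "(\<integral>x. indicator {0<..<1} x * f x \<partial>lborel) = 0"
proof -
  have [measurable]: "f \<in> borel_measurable borel"
    by (rule borel_measurable_continuous_onI) fact
  have "(\<integral>x. indicator {0<..<1} x * f x \<partial>lborel) = (\<integral>x. f x * indicator {0..1} x \<partial>lborel)"
  proof (rule integral_cong_AE)
    show "AE x in lborel. indicator {0<..<1} x * f x = f x * indicator {0..1} x"
      using AE_lborel_singleton[of 0] AE_lborel_singleton[of 1]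
      by eventually_elim (auto simp: indicator_def)
  qed measurable
  also have "\<dots> = F 1 - F 0"
    using assms by (intro integral_FTC_Icc_real) (auto simp: continuous_on_eq_continuous_at)
  finally show ?thesis using assms by simp
qed

text \<open>For every y the points (0, y) and (1, y) lie outside the open square, so the fundamental
  theorem of calculus makes each inner integral zero. Integration by parts and the Poincare
  inequality both come from suitable choices of \<psi>.\<close>

lemma integral_partial1_zero:
  fixes \<psi> D :: "real \<times> real \<Rightarrow> real"
  assumes deriv: "\<And>x y. ((\<lambda>t. \<psi> (t, y)) has_real_derivative D (x, y)) (at x)"
    and D: "continuous_on UNIV D" and zero: "\<And>z. z \<notin> Omega \<Longrightarrow> \<psi> z = 0"
  shows "(\<integral>z. D z \<partial>LOm) = 0"
proof -
  have "(\<integral>x. indicator Omega (x, y) * D (x, y) \<partial>lborel) = 0" for y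
  proof -
    have "(\<integral>x. indicator {0<..<1} x * D (x, y) \<partial>lborel) = 0"
      by (rule integral_derivative_unit_interval[OF deriv])
        (auto intro!: zero continuous_on_compose2[OF D] continuous_intros simp: Omega_def)
    then have "indicator {0<..<1} y * (\<integral>x. indicator {0<..<1} x * D (x, y) \<partial>lborel) = 0"
      by simp
    then show ?thesis
      by (cases "y \<in> {0<..<1}") (auto simp: Omega_def indicator_times)
  qed
  then show ?thesis by (simp add: lebesgue_on_Omega_Fubini(2)[OF D])
qed

lemma integral_partial2_zero:
  fixes \<psi> D :: "real \<times> real \<Rightarrow> real"
  assumes deriv: "\<And>x y. ((\<lambda>t. \<psi> (x, t)) has_real_derivative D (x, y)) (at y)"
    and D: "continuous_on UNIV D" and zero: "\<And>z. z \<notin> Omega \<Longrightarrow> \<psi> z = 0"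
  shows "(\<integral>z. D z \<partial>LOm) = 0"
proof -
  have "(\<integral>y. indicator Omega (x, y) * D (x, y) \<partial>lborel) = 0" for x
  proof -
    have "(\<integral>y. indicator {0<..<1} y * D (x, y) \<partial>lborel) = 0"
      by (rule integral_derivative_unit_interval[OF deriv])
        (auto intro!: zero continuous_on_compose2[OF D] continuous_intros simp: Omega_def)
    then show ?thesis
      by (cases "x \<in> {0<..<1}") (auto simp: Omega_def indicator_times)
  qed
  then show ?thesis by (simp add: lebesgue_on_Omega_Fubini(1)[OF D])
qed

section \<open>Calculus of smooth functions and test functions\<close>

lemma smooth2_iter_pd: "smooth2 \<phi> \<Longrightarrow> smooth2 (iter_pd bs \<phi>)"
proof -
  have "iter_pd cs (iter_pd bs \<phi>) = iter_pd (cs @ bs) \<phi>" for cs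
    by (induction cs) auto
  then show "smooth2 \<phi> \<Longrightarrow> smooth2 (iter_pd bs \<phi>)"
    by (simp add: smooth2_def)
qed

lemma smooth2_pd:
  assumes "smooth2 \<phi>" shows "smooth2 (pd1 \<phi>)" "smooth2 (pd2 \<phi>)"
  using smooth2_iter_pd[OF assms, of "[True]"] smooth2_iter_pd[OF assms, of "[False]"] by auto

lemma smooth2_differentiable: "smooth2 \<phi> \<Longrightarrow> \<phi> differentiable (at x)"
  unfolding smooth2_def by (metis iter_pd.simps(1))

lemma smooth2_continuous: "smooth2 \<phi> \<Longrightarrow> continuous_on S \<phi>"
  by (intro differentiable_imp_continuous_on)
    (auto simp: differentiable_on_def intro: differentiable_at_withinI smooth2_differentiable)

lemma differentiable_has_pd1:
  assumes "\<phi> differentiable (at (x, y))"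
  shows "((\<lambda>t. \<phi> (t, y)) has_real_derivative pd1 \<phi> (x, y)) (at x)"
proof -
  have "(\<phi> \<circ> (\<lambda>t. (t, y))) differentiable (at x)"
    using assms by (intro differentiable_chain_at) (auto intro!: derivative_intros)
  then have "(\<lambda>t. \<phi> (t, y)) field_differentiable (at x)"
    by (simp add: o_def field_differentiable_def real_differentiable_def)
  then show ?thesis
    by (simp add: pd1_def DERIV_deriv_iff_field_differentiable)
qed

lemma differentiable_has_pd2:
  assumes "\<phi> differentiable (at (x, y))"
  shows "((\<lambda>t. \<phi> (x, t)) has_real_derivative pd2 \<phi> (x, y)) (at y)"
proof -
  have "(\<phi> \<circ> (\<lambda>t. (x, t))) differentiable (at y)"
    using assms by (intro differentiable_chain_at) (auto intro!: derivative_intros)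
  then have "(\<lambda>t. \<phi> (x, t)) field_differentiable (at y)"
    by (simp add: o_def field_differentiable_def real_differentiable_def)
  then show ?thesis
    by (simp add: pd2_def DERIV_deriv_iff_field_differentiable)
qed

lemmas smooth2_has_pd1 = differentiable_has_pd1[OF smooth2_differentiable]
lemmas smooth2_has_pd2 = differentiable_has_pd2[OF smooth2_differentiable]

lemma pd1_eqI: "(\<And>x y. ((\<lambda>t. \<phi> (t, y)) has_real_derivative D (x, y)) (at x)) \<Longrightarrow> pd1 \<phi> = D"
  by (auto simp: pd1_def fun_eq_iff intro!: DERIV_imp_deriv)

lemma pd2_eqI: "(\<And>x y. ((\<lambda>t. \<phi> (x, t)) has_real_derivative D (x, y)) (at y)) \<Longrightarrow> pd2 \<phi> = D"
  by (auto simp: pd2_def fun_eq_iff intro!: DERIV_imp_deriv)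

lemma pd_linear:
  assumes "smooth2 \<phi>" "smooth2 \<psi>"
  shows "pd1 (\<lambda>x. \<phi> x + c * \<psi> x) = (\<lambda>x. pd1 \<phi> x + c * pd1 \<psi> x)"
    and "pd2 (\<lambda>x. \<phi> x + c * \<psi> x) = (\<lambda>x. pd2 \<phi> x + c * pd2 \<psi> x)"
  by (intro pd1_eqI pd2_eqI DERIV_add DERIV_cmult smooth2_has_pd1 smooth2_has_pd2 assms)+

lemma smooth2_linear:
  assumes "smooth2 \<phi>" "smooth2 \<psi>"
  shows "smooth2 (\<lambda>x. \<phi> x + c * \<psi> x)"
proof -
  have "iter_pd bs (\<lambda>x. \<phi> x + c * \<psi> x) = (\<lambda>x. iter_pd bs \<phi> x + c * iter_pd bs \<psi> x)" for bs
    by (induction bs) (auto simp: pd_linear smooth2_iter_pd assms)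
  then show ?thesis
    using assms by (auto simp: smooth2_def intro!: derivative_intros)
qed

lemma test_fun_smooth: "test_fun \<phi> \<Longrightarrow> smooth2 \<phi>"
  by (simp add: test_fun_def)

lemma test_funI:
  assumes "smooth2 \<phi>" "compact K" "K \<subseteq> Omega" "\<And>x. x \<notin> K \<Longrightarrow> \<phi> x = 0"
  shows "test_fun \<phi>"
proof -
  have "closure {x. \<phi> x \<noteq> 0} \<subseteq> K"
    using assms by (intro closure_minimal) (auto intro: compact_imp_closed)
  moreover from this have "compact (closure {x. \<phi> x \<noteq> 0})"
    using compact_Int_closed[OF assms(2) closed_closure] by (metis Int_absorb1)
  ultimately show ?thesis
    using assms by (auto simp: test_fun_def)
qed

lemma test_funE:
  assumes "test_fun \<phi>"
  obtains K where "compact K" "K \<subseteq> Omega" "\<And>x. x \<notin> K \<Longrightarrow> \<phi> x = 0"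
  using assms closure_subset[of "{x. \<phi> x \<noteq> 0}"]
  by (intro that[of "closure {x. \<phi> x \<noteq> 0}"]) (auto simp: test_fun_def)

lemma test_fun_zero: "test_fun \<phi> \<Longrightarrow> z \<notin> Omega \<Longrightarrow> \<phi> z = 0"
  by (metis test_funE subsetD)

lemma test_fun_linear:
  assumes "test_fun \<phi>" "test_fun \<psi>"
  shows "test_fun (\<lambda>x. \<phi> x + c * \<psi> x)"
proof -
  obtain K where K: "compact K" "K \<subseteq> Omega" "\<And>x. x \<notin> K \<Longrightarrow> \<phi> x = 0"
    using test_funE[OF assms(1)] by metis
  obtain L where L: "compact L" "L \<subseteq> Omega" "\<And>x. x \<notin> L \<Longrightarrow> \<psi> x = 0"
    using test_funE[OF assms(2)] by metis
  show ?thesis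
  proof (rule test_funI[where K = "K \<union> L"])
    show "smooth2 (\<lambda>x. \<phi> x + c * \<psi> x)"
      by (intro smooth2_linear test_fun_smooth assms)
    show "compact (K \<union> L)" using K L by blast
    show "K \<union> L \<subseteq> Omega" using K L by blast
    show "\<phi> x + c * \<psi> x = 0" if "x \<notin> K \<union> L" for x
      using that K(3)[of x] L(3)[of x] by simp
  qed
qed

lemma test_fun_diff: "test_fun \<phi> \<Longrightarrow> test_fun \<psi> \<Longrightarrow> test_fun (\<lambda>x. \<phi> x - \<psi> x)"
  using test_fun_linear[of \<phi> \<psi> "-1"] by simp

lemma test_fun_const_zero: "test_fun (\<lambda>_. 0)"
proof (rule test_funI[where K = "{}"])
  have "iter_pd bs (\<lambda>_. 0) = (\<lambda>_. 0)" for bs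
    by (induction bs) (auto simp: pd1_def pd2_def)
  then show "smooth2 (\<lambda>_. 0)" by (simp add: smooth2_def)
qed auto

lemma test_fun_L2:
  assumes "test_fun \<phi>"
  shows "square_integrable LOm \<phi>" "square_integrable LOm (pd1 \<phi>)" "square_integrable LOm (pd2 \<phi>)"
  by (intro continuous_square_integrable_Omega smooth2_continuous smooth2_pd test_fun_smooth[OF assms])+

text \<open>The product of \<psi> and \<phi> already vanishes outside the square, so \<psi> needs no
  boundary condition. For smooth functions the classical partial derivatives thereby act as weak
  ones.\<close>

lemma test_fun_by_parts:
  assumes \<phi>: "test_fun \<phi>" and \<psi>: "smooth2 \<psi>"
  shows "(\<integral>x. \<psi> x * pd1 \<phi> x \<partial>LOm) = - (\<integral>x. pd1 \<psi> x * \<phi> x \<partial>LOm)"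
    and "(\<integral>x. \<psi> x * pd2 \<phi> x \<partial>LOm) = - (\<integral>x. pd2 \<psi> x * \<phi> x \<partial>LOm)"
proof -
  note s = test_fun_smooth[OF \<phi>] \<psi>
  have sq: "square_integrable LOm f" if "smooth2 f" for f
    using that by (intro continuous_square_integrable_Omega smooth2_continuous)
  note cont = smooth2_continuous[OF s(1)] smooth2_continuous[OF s(2)]
    smooth2_continuous[OF smooth2_pd(1)[OF s(1)]] smooth2_continuous[OF smooth2_pd(1)[OF s(2)]]
    smooth2_continuous[OF smooth2_pd(2)[OF s(1)]] smooth2_continuous[OF smooth2_pd(2)[OF s(2)]]
  note int = square_integrable_mult[OF sq sq]
  have "(\<integral>x. \<psi> x * pd1 \<phi> x + pd1 \<psi> x * \<phi> x \<partial>LOm) = 0"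
    by (rule integral_partial1_zero[where \<psi> = "\<lambda>x. \<psi> x * \<phi> x"])
      (auto intro!: DERIV_mult'[THEN DERIV_cong] smooth2_has_pd1 continuous_on_add continuous_on_mult cont s
        simp: test_fun_zero[OF \<phi>])
  then show "(\<integral>x. \<psi> x * pd1 \<phi> x \<partial>LOm) = - (\<integral>x. pd1 \<psi> x * \<phi> x \<partial>LOm)"
    using int s smooth2_pd by (subst (asm) Bochner_Integration.integral_add) auto
  have "(\<integral>x. \<psi> x * pd2 \<phi> x + pd2 \<psi> x * \<phi> x \<partial>LOm) = 0"
    by (rule integral_partial2_zero[where \<psi> = "\<lambda>x. \<psi> x * \<phi> x"])
      (auto intro!: DERIV_mult'[THEN DERIV_cong] smooth2_has_pd2 continuous_on_add continuous_on_mult cont s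
        simp: test_fun_zero[OF \<phi>])
  then show "(\<integral>x. \<psi> x * pd2 \<phi> x \<partial>LOm) = - (\<integral>x. pd2 \<psi> x * \<phi> x \<partial>LOm)"
    using int s smooth2_pd by (subst (asm) Bochner_Integration.integral_add) auto
qed

text \<open>Integrating the \<open>x\<^sub>1\<close>-derivative of \<open>x\<^sub>1 \<phi>\<^sup>2\<close> gives
  \<open>\<parallel>\<phi>\<parallel>\<^sup>2 = - 2 \<integral> x\<^sub>1 \<phi> \<partial>\<^sub>1\<phi> \<le> \<parallel>\<phi>\<parallel>\<^sup>2 / 2 + 2 \<parallel>\<partial>\<^sub>1\<phi>\<parallel>\<^sup>2\<close>.\<close>
lemma Poincare_test_fun:
  assumes \<phi>: "test_fun \<phi>"
  shows "(\<integral>x. (\<phi> x)\<^sup>2 \<partial>LOm) \<le> 4 * (\<integral>x. (pd1 \<phi> x)\<^sup>2 \<partial>LOm)"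
proof -
  note s = test_fun_smooth[OF \<phi>]
  note L = test_fun_L2[OF \<phi>]
  have L': "square_integrable LOm (\<lambda>x. fst x * \<phi> x)"
    by (intro continuous_square_integrable_Omega continuous_intros smooth2_continuous s)
  have "(\<integral>x. (\<phi> x)\<^sup>2 + 2 * (fst x * \<phi> x * pd1 \<phi> x) \<partial>LOm) = 0"
  proof (rule integral_partial1_zero[where \<psi> = "\<lambda>x. fst x * (\<phi> x * \<phi> x)"])
    fix x y
    show "((\<lambda>t. fst (t, y) * (\<phi> (t, y) * \<phi> (t, y))) has_real_derivative
        (\<phi> (x, y))\<^sup>2 + 2 * (fst (x, y) * \<phi> (x, y) * pd1 \<phi> (x, y))) (at x)"
      by (auto intro!: derivative_eq_intros smooth2_has_pd1 s simp: power2_eq_square algebra_simps)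
  qed (auto intro!: continuous_intros smooth2_continuous[OF s] smooth2_continuous[OF smooth2_pd(1)[OF s]]
      simp: test_fun_zero[OF \<phi>])
  then have eq: "(\<integral>x. (\<phi> x)\<^sup>2 \<partial>LOm) = (\<integral>x. - 2 * (fst x * \<phi> x * pd1 \<phi> x) \<partial>LOm)"
    using square_integrable_mult[OF L' L(2)] square_integrable_power2[OF L(1)]
    by (subst (asm) Bochner_Integration.integral_add) auto
  also have "\<dots> \<le> (\<integral>x. (\<phi> x)\<^sup>2 / 2 + 2 * (pd1 \<phi> x)\<^sup>2 \<partial>LOm)"
  proof (rule integral_mono)
    fix x assume "x \<in> space LOm"
    then have "\<bar>fst x\<bar> \<le> 1" by (auto simp: Omega_def)
    have "- 2 * (fst x * \<phi> x * pd1 \<phi> x) \<le> \<bar>fst x\<bar> * (2 * (\<bar>\<phi> x\<bar> * \<bar>pd1 \<phi> x\<bar>))"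
      using abs_ge_minus_self[of "2 * (fst x * \<phi> x * pd1 \<phi> x)"]
      by (simp add: abs_mult mult_ac)
    also have "\<dots> \<le> 2 * (\<bar>\<phi> x\<bar> * \<bar>pd1 \<phi> x\<bar>)"
      using \<open>\<bar>fst x\<bar> \<le> 1\<close> by (intro mult_left_le_one_le) auto
    also have "\<dots> \<le> (\<phi> x)\<^sup>2 / 2 + 2 * (pd1 \<phi> x)\<^sup>2"
      using sum_squares_bound[of "\<bar>\<phi> x\<bar>" "2 * \<bar>pd1 \<phi> x\<bar>"] by (simp add: power_mult_distrib)
    finally show "- 2 * (fst x * \<phi> x * pd1 \<phi> x) \<le> (\<phi> x)\<^sup>2 / 2 + 2 * (pd1 \<phi> x)\<^sup>2" .
  qed (use square_integrable_mult[OF L' L(2)] L in \<open>auto simp: square_integrable_power2\<close>)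
  also have "\<dots> = (\<integral>x. (\<phi> x)\<^sup>2 \<partial>LOm) / 2 + 2 * (\<integral>x. (pd1 \<phi> x)\<^sup>2 \<partial>LOm)"
    using L by (simp add: square_integrable_power2)
  finally show ?thesis by simp
qed

section \<open>Uniqueness of weak derivatives\<close>

text \<open>The classical smooth function exp(-c/s), extended by zero, with an extra power of 1/s.
  The power is there because differentiation produces it: the derivative is again a combination of
  members of the family.\<close>

definition flat_exp :: "nat \<Rightarrow> real \<Rightarrow> real \<Rightarrow> real" where
  "flat_exp k c s = (if s > 0 then (1 / s) ^ k * exp (- c / s) else 0)"

lemma power_div_fact_le_exp:
  fixes x :: real
  assumes "x \<ge> 0"
  shows "x ^ n / fact n \<le> exp x"
proof -
  have "(\<Sum>k\<in>{n}. x ^ k /\<^sub>R fact k) \<le> (\<Sum>k. x ^ k /\<^sub>R fact k)"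
    using assms by (intro sum_le_suminf summable_exp_generic) auto
  then show ?thesis by (simp add: exp_def divide_inverse mult.commute)
qed

text \<open>The term of degree k + 2 in the series of exp(c/s) beats the factor (1/s)^k with two
  powers of s to spare. Two are needed so that the difference quotient at 0 still tends to
  0.\<close>

lemma flat_exp_quadratic_bound:
  assumes "c > 0"
  shows "\<bar>flat_exp k c s\<bar> \<le> fact (k + 2) / c ^ (k + 2) * s\<^sup>2"
proof (cases "s > 0")
  case True
  have le: "(c / s) ^ (k + 2) / fact (k + 2) \<le> exp (c / s)"
    using True assms by (intro power_div_fact_le_exp) auto
  have "exp (- c / s) = 1 / exp (c / s)" by (simp add: exp_minus field_simps)
  also have "\<dots> \<le> 1 / ((c / s) ^ (k + 2) / fact (k + 2))"
    using True assms by (intro divide_left_mono le) auto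
  finally have "(1 / s) ^ k * exp (- c / s) \<le> (1 / s) ^ k * (1 / ((c / s) ^ (k + 2) / fact (k + 2)))"
    using True by (intro mult_left_mono) auto
  also have "\<dots> = fact (k + 2) / c ^ (k + 2) * s\<^sup>2"
    using True assms by (simp add: power_divide power_add power2_eq_square field_simps del: fact_Suc)
  finally show ?thesis using True by (simp add: flat_exp_def)
qed (use assms in \<open>simp add: flat_exp_def\<close>)

lemma flat_exp_has_derivative:
  assumes "c > 0"
  shows "(flat_exp k c has_real_derivative
      c * flat_exp (k + 2) c s - real k * flat_exp (k + 1) c s) (at s)"
proof -
  consider "s > 0" | "s = 0" | "s < 0" by linarith
  then show ?thesis
  proof cases
    case 1
    have "((\<lambda>s. (1 / s) ^ k * exp (- c / s)) has_real_derivative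
        c * flat_exp (k + 2) c s - real k * flat_exp (k + 1) c s) (at s)"
    proof -
      \<comment> \<open>The power rule produces exponents of the form \<open>j - Suc 0\<close>;
        truncated subtraction breaks the recombination only at \<open>j = 0\<close>.\<close>
      have pow: "j = 0" if "s ^ j \<noteq> s * s ^ (j - Suc 0)" for j
        using that by (cases j) auto
      show ?thesis
        using 1 by (cases k)
          (auto intro!: derivative_eq_intros simp: flat_exp_def power2_eq_square field_simps
            dest: pow)
    qed
    then show ?thesis
      by (rule has_field_derivative_transform_within_open[where S = "{0<..}"])
        (use 1 in \<open>auto simp: flat_exp_def\<close>)
  next
    case 3
    have "((\<lambda>s. 0) has_real_derivative 0) (at s)" by simp
    then have "(flat_exp k c has_real_derivative 0) (at s)"
      by (rule has_field_derivative_transform_within_open[where S = "{..<0}"])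
        (use 3 in \<open>auto simp: flat_exp_def\<close>)
    then show ?thesis using 3 by (simp add: flat_exp_def)
  next
    case 2
    let ?K = "fact (k + 2) / c ^ (k + 2) :: real"
    have "((\<lambda>t. flat_exp k c t / t) \<longlongrightarrow> 0) (at 0)"
    proof (rule Lim_null_comparison)
      have "norm (flat_exp k c t / t) \<le> ?K * \<bar>t\<bar>" for t
      proof (cases "t = 0")
        case False
        then show ?thesis
          using flat_exp_quadratic_bound[OF assms, of k t]
          by (simp add: pos_divide_le_eq power2_eq_square mult.assoc abs_divide del: fact_Suc)
      qed simp
      then show "\<forall>\<^sub>F t in at 0. norm (flat_exp k c t / t) \<le> ?K * \<bar>t\<bar>" by simp
      show "((\<lambda>t. ?K * \<bar>t\<bar>) \<longlongrightarrow> 0) (at 0)"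
        by (rule tendsto_eq_intros refl | use assms in simp)+
    qed
    then show ?thesis
      using 2 by (simp add: has_field_derivative_iff flat_exp_def)
  qed
qed

text \<open>Affine substitutions of flat exponentials, together with constants, sums and products:
  just enough for the set to be closed under differentiation. Smoothness of all orders then follows
  from this closure, with no formula for higher derivatives.\<close>

inductive_set flat_algebra :: "(real \<Rightarrow> real) set" where
  flat: "c > 0 \<Longrightarrow> (\<lambda>t. flat_exp k c (m * t + d)) \<in> flat_algebra"
| const: "(\<lambda>t. d) \<in> flat_algebra"
| add: "\<alpha> \<in> flat_algebra \<Longrightarrow> \<beta> \<in> flat_algebra \<Longrightarrow> (\<lambda>t. \<alpha> t + \<beta> t) \<in> flat_algebra"
| mult: "\<alpha> \<in> flat_algebra \<Longrightarrow> \<beta> \<in> flat_algebra \<Longrightarrow> (\<lambda>t. \<alpha> t * \<beta> t) \<in> flat_algebra"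

lemma flat_algebra_derivative:
  assumes "\<alpha> \<in> flat_algebra"
  shows "\<exists>\<alpha>'\<in>flat_algebra. \<forall>t. (\<alpha> has_real_derivative \<alpha>' t) (at t)"
  using assms
proof induction
  case (flat c k m d)
  have "((\<lambda>t. flat_exp k c (m * t + d)) has_real_derivative
      (c * m) * flat_exp (k + 2) c (m * t + d) + (- real k * m) * flat_exp (k + 1) c (m * t + d)) (at t)" for t
    by (rule DERIV_cong[OF DERIV_chain2[OF flat_exp_has_derivative[OF flat]]])
      (auto intro!: derivative_eq_intros simp: algebra_simps)
  moreover have "(\<lambda>t. (c * m) * flat_exp (k + 2) c (m * t + d) + (- real k * m) * flat_exp (k + 1) c (m * t + d))
      \<in> flat_algebra"
    by (intro flat_algebra.intros flat)
  ultimately show ?case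
    by (intro bexI[where x = "\<lambda>t. (c * m) * flat_exp (k + 2) c (m * t + d)
      + (- real k * m) * flat_exp (k + 1) c (m * t + d)"]) simp_all
next
  case (const d)
  show ?case by (rule bexI[OF _ flat_algebra.const[of 0]]) simp
next
  case (add \<alpha> \<beta>)
  then obtain \<alpha>' \<beta>' where "\<alpha>' \<in> flat_algebra" "\<beta>' \<in> flat_algebra"
    "\<forall>t. (\<alpha> has_real_derivative \<alpha>' t) (at t)" "\<forall>t. (\<beta> has_real_derivative \<beta>' t) (at t)" by blast
  then show ?case
    by (intro bexI[where x = "\<lambda>t. \<alpha>' t + \<beta>' t"]) (auto intro: DERIV_add flat_algebra.intros)
next
  case (mult \<alpha> \<beta>)
  then obtain \<alpha>' \<beta>' where "\<alpha>' \<in> flat_algebra" "\<beta>' \<in> flat_algebra"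
    "\<forall>t. (\<alpha> has_real_derivative \<alpha>' t) (at t)" "\<forall>t. (\<beta> has_real_derivative \<beta>' t) (at t)" by blast
  with mult show ?case
    by (intro bexI[where x = "\<lambda>t. \<alpha> t * \<beta>' t + \<alpha>' t * \<beta> t"]) (auto intro: DERIV_mult' flat_algebra.intros)
qed

lemma flat_algebra_differentiable:
  assumes "\<alpha> \<in> flat_algebra" shows "\<alpha> differentiable (at t)"
  using flat_algebra_derivative[OF assms] real_differentiable_def by blast

text \<open>A partial derivative acts on one factor of a product of one-variable functions and
  leaves the other alone, so by induction every iterated derivative is again such a product with
  factors in \<open>flat_algebra\<close>.\<close>

lemma smooth2_tensor:
  assumes "\<alpha> \<in> flat_algebra" "\<beta> \<in> flat_algebra"
  shows "smooth2 (\<lambda>x. \<alpha> (fst x) * \<beta> (snd x))"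
proof -
  have "\<exists>\<alpha>'\<in>flat_algebra. \<exists>\<beta>'\<in>flat_algebra.
      iter_pd bs (\<lambda>x. \<alpha> (fst x) * \<beta> (snd x)) = (\<lambda>x. \<alpha>' (fst x) * \<beta>' (snd x))" for bs
  proof (induction bs)
    case Nil
    then show ?case using assms by auto
  next
    case (Cons b bs)
    then obtain \<alpha>' \<beta>' where ab: "\<alpha>' \<in> flat_algebra" "\<beta>' \<in> flat_algebra"
      and eq: "iter_pd bs (\<lambda>x. \<alpha> (fst x) * \<beta> (snd x)) = (\<lambda>x. \<alpha>' (fst x) * \<beta>' (snd x))" by blast
    obtain \<alpha>'' where a: "\<alpha>'' \<in> flat_algebra" "\<And>t. (\<alpha>' has_real_derivative \<alpha>'' t) (at t)"
      using flat_algebra_derivative[OF ab(1)] by blast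
    obtain \<beta>'' where b: "\<beta>'' \<in> flat_algebra" "\<And>t. (\<beta>' has_real_derivative \<beta>'' t) (at t)"
      using flat_algebra_derivative[OF ab(2)] by blast
    have "pd1 (\<lambda>x. \<alpha>' (fst x) * \<beta>' (snd x)) = (\<lambda>x. \<alpha>'' (fst x) * \<beta>' (snd x))"
      by (rule pd1_eqI) (auto intro!: DERIV_cmult_right a)
    moreover have "pd2 (\<lambda>x. \<alpha>' (fst x) * \<beta>' (snd x)) = (\<lambda>x. \<alpha>' (fst x) * \<beta>'' (snd x))"
      by (rule pd2_eqI) (auto intro!: DERIV_cmult b)
    ultimately show ?case
      using ab a(1) b(1) by (cases b) (auto simp: eq)
  qed
  moreover have "(\<lambda>x. \<alpha> (fst x) * \<beta> (snd x)) differentiable (at z)"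
    if "\<alpha> \<in> flat_algebra" "\<beta> \<in> flat_algebra" for \<alpha> \<beta> and z :: "real \<times> real"
  proof (rule differentiable_mult)
    show "(\<lambda>x. \<alpha> (fst x)) differentiable (at z)"
      using differentiable_chain_at[of fst z \<alpha>] flat_algebra_differentiable[OF that(1)]
      by (auto simp: o_def bounded_linear_imp_differentiable bounded_linear_fst)
    show "(\<lambda>x. \<beta> (snd x)) differentiable (at z)"
      using differentiable_chain_at[of snd z \<beta>] flat_algebra_differentiable[OF that(2)]
      by (auto simp: o_def bounded_linear_imp_differentiable bounded_linear_snd)
  qed
  ultimately show ?thesis
    unfolding smooth2_def by metis
qed

text \<open>On the open interval this equals exp(-(1/(t-a) + 1/(b-t)) / (n+1)). The \<open>n\<close>
  only scales the exponent; the support stays inside the same closed interval for all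
  \<open>n\<close>, so the approximation is from inside.\<close>

definition bump :: "nat \<Rightarrow> real \<Rightarrow> real \<Rightarrow> real \<Rightarrow> real" where
  "bump n a b t = flat_exp 0 (1 / Suc n) (t - a) * flat_exp 0 (1 / Suc n) (b - t)"

lemma bump_smooth: "bump n a b \<in> flat_algebra"
proof -
  have "(\<lambda>t. flat_exp 0 (1 / Suc n) (1 * t + (- a)) * flat_exp 0 (1 / Suc n) ((-1) * t + b)) \<in> flat_algebra"
    by (intro flat_algebra.intros) auto
  also have "(\<lambda>t. flat_exp 0 (1 / Suc n) (1 * t + (- a)) * flat_exp 0 (1 / Suc n) ((-1) * t + b)) = bump n a b"
    by (simp add: bump_def fun_eq_iff)
  finally show ?thesis .
qed

lemma flat_exp_0_le: "c > 0 \<Longrightarrow> 0 \<le> flat_exp 0 c s \<and> flat_exp 0 c s \<le> 1"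
  by (simp add: flat_exp_def)

lemma bump_bounds: "0 \<le> bump n a b t" "bump n a b t \<le> 1"
  unfolding bump_def by (simp_all add: flat_exp_0_le mult_le_one)

lemma bump_zero: "t \<notin> {a<..<b} \<Longrightarrow> bump n a b t = 0"
  by (auto simp: bump_def flat_exp_def)

lemma flat_exp_0_tendsto: "s > 0 \<Longrightarrow> (\<lambda>n. flat_exp 0 (1 / Suc n) s) \<longlonglongrightarrow> 1"
proof -
  assume s: "s > 0"
  have "(\<lambda>n. exp (- (1 / Suc n) / s)) \<longlonglongrightarrow> exp (- 0 / s)"
    by (intro tendsto_intros LIMSEQ_Suc[OF lim_1_over_n]) (use s in auto)
  then show ?thesis using s by (simp add: flat_exp_def)
qed

text \<open>\<open>bump n a b\<close> is the \<open>(n + 1)\<close>-st root of \<open>bump 0 a b\<close>.\<close>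
lemma bump_tendsto: "(\<lambda>n. bump n a b t) \<longlonglongrightarrow> indicator {a<..<b} t"
proof (cases "t \<in> {a<..<b}")
  case True
  then have "(\<lambda>n. bump n a b t) \<longlonglongrightarrow> 1 * 1"
    unfolding bump_def by (intro tendsto_mult flat_exp_0_tendsto) auto
  with True show ?thesis by simp
qed (simp add: bump_zero)

lemma test_fun_bump:
  assumes "cbox (a, c) (b, d) \<subseteq> Omega"
  shows "test_fun (\<lambda>x. bump n a b (fst x) * bump n c d (snd x))"
proof (rule test_funI[OF smooth2_tensor[OF bump_smooth bump_smooth] compact_cbox assms])
  fix x assume "x \<notin> cbox (a, c) (b, d)"
  then have "fst x \<notin> {a<..<b} \<or> snd x \<notin> {c<..<d}" by (cases x) auto
  then show "bump n a b (fst x) * bump n c d (snd x) = 0" by (auto simp: bump_zero)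
qed

section \<open>The fundamental lemma of the calculus of variations\<close>

text \<open>Boxes are closed under intersection and generate the Borel sets, so Dynkin's argument
  extends the vanishing to all Borel sets, and a function with zero integral over each of them is
  null. Since this concerns Borel sets, \<open>k\<close> is first replaced by a Borel version
  \<open>g\<close>.\<close>

lemma AE_zero_of_box_integrals_zero:
  fixes k :: "'a::euclidean_space \<Rightarrow> real"
  assumes k: "integrable lebesgue k"
    and box: "\<And>a b. (\<integral>x. indicator (box a b) x * k x \<partial>lebesgue) = 0"
  shows "AE x in lebesgue. k x = 0"
proof -
  obtain g where g [measurable]: "g \<in> borel_measurable lborel" and kg: "AE x in lborel. k x = g x"
    using completion_ex_borel_measurable_real[of k lborel] k by blast
  have kg': "AE x in lebesgue. k x = g x" by (rule AE_completion[OF kg])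
  have km: "k \<in> borel_measurable lebesgue" using k by simp
  have gm: "g \<in> borel_measurable lebesgue" by (rule measurable_completion) fact
  have "integrable lebesgue g"
    using integrable_cong_AE[OF km gm kg'] k by simp
  then have gint: "integrable lborel g" by (simp add: integrable_completion)
  have gint_ind: "integrable lborel (\<lambda>x. indicator A x * g x)" if "A \<in> sets borel" for A
    using integrable_mult_indicator[OF _ gint, of A] that by simp
  have gbox: "(\<integral>x. indicator (box a b) x * g x \<partial>lborel) = 0" for a b
  proof -
    have "(\<integral>x. indicator (box a b) x * g x \<partial>lborel) = (\<integral>x. indicator (box a b) x * g x \<partial>lebesgue)"
      by (rule integral_completion[symmetric]) measurable
    also have "\<dots> = (\<integral>x. indicator (box a b) x * k x \<partial>lebesgue)"
      by (rule integral_cong_AE)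
        (use kg' km gm in \<open>auto intro!: borel_measurable_times borel_measurable_indicator\<close>)
    finally show ?thesis using box by simp
  qed
  \<comment> \<open>Needed for complements in the Dynkin induction: the whole space is not a box but
    a limit of growing ones.\<close>
  have tot: "(\<integral>x. g x \<partial>lborel) = 0"
  proof -
    have "(\<lambda>n. \<integral>x. indicator (box (- (real n *\<^sub>R One)) (real n *\<^sub>R One)) x * g x \<partial>lborel)
        \<longlonglongrightarrow> (\<integral>x. g x \<partial>lborel)"
    proof (rule integral_dominated_convergence[where w = "\<lambda>x. \<bar>g x\<bar>"])
      show "AE x in lborel. (\<lambda>n. indicator (box (- (real n *\<^sub>R One)) (real n *\<^sub>R One)) x * g x) \<longlonglongrightarrow> g x"
      proof (rule AE_I2)
        fix x :: 'a
        have "x \<in> (\<Union>i::nat. box (- (real i *\<^sub>R One)) (real i *\<^sub>R One))"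
          unfolding UN_box_eq_UNIV by simp
        then obtain N where N: "x \<in> box (- (real N *\<^sub>R One)) (real N *\<^sub>R One)" by blast
        have "x \<in> box (- (real n *\<^sub>R One)) (real n *\<^sub>R One)" if "n \<ge> N" for n
          using N that by (force simp: mem_box)
        then have "\<forall>\<^sub>F n in sequentially. indicator (box (- (real n *\<^sub>R One)) (real n *\<^sub>R One)) x * g x = g x"
          by (auto simp: eventually_sequentially intro!: exI[of _ N])
        then show "(\<lambda>n. indicator (box (- (real n *\<^sub>R One)) (real n *\<^sub>R One)) x * g x) \<longlonglongrightarrow> g x"
          by (rule tendsto_eventually)
      qed
    qed (use gint in \<open>auto simp: indicator_def\<close>)
    then show ?thesis by (simp add: gbox LIMSEQ_const_iff)
  qed
  have sets0: "(\<integral>x. indicator A x * g x \<partial>lborel) = 0" if A: "A \<in> sets borel" for A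
  proof -
    have "Int_stable (range (\<lambda>(a, b). box a b :: 'a set))"
      by (auto simp: Int_stable_def box_Int_box)
    moreover have "range (\<lambda>(a, b). box a b :: 'a set) \<subseteq> Pow UNIV" by auto
    moreover have "A \<in> sigma_sets UNIV (range (\<lambda>(a, b). box a b))"
      using A unfolding borel_eq_box by simp
    ultimately show ?thesis
    proof (induction rule: sigma_sets_induct_disjoint)
      case (basic A)
      then show ?case using gbox by auto
    next
      case empty
      then show ?case by simp
    next
      case (compl A)
      then have "A \<in> sets borel" by (simp add: borel_eq_box)
      have "(\<integral>x. indicator (UNIV - A) x * g x \<partial>lborel) = (\<integral>x. g x - indicator A x * g x \<partial>lborel)"
        by (intro Bochner_Integration.integral_cong) (auto simp: indicator_def)
      also have "\<dots> = 0"
        using gint gint_ind[OF \<open>A \<in> sets borel\<close>] compl tot by simp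
      finally show ?case .
    next
      case (union F)
      then have F [measurable]: "F i \<in> sets borel" for i
        by (auto simp add: borel_eq_box subset_eq)
      have "set_lebesgue_integral lborel (\<Union>i. F i) g = (\<Sum>i. set_lebesgue_integral lborel (F i) g)"
        using union(1) gint_ind[of "\<Union>i. F i"]
        by (intro lebesgue_integral_countable_add) (auto simp: disjoint_family_on_def set_integrable_def)
      then show ?case
        using union.IH by (simp add: set_lebesgue_integral_def)
    qed
  qed
  have "AE x in lborel. g x = 0"
    by (rule sigma_finite_measure.density_zero[OF lborel.sigma_finite_measure_axioms gint]) (simp add: set_lebesgue_integral_def sets0)
  then have "AE x in lborel. k x = 0" using kg by eventually_elim simp
  then show ?thesis by (rule AE_completion)
qed

lemma integrable_lebesgue_on_iff:
  fixes g :: "'a::euclidean_space \<Rightarrow> real"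
  assumes "S \<in> sets lebesgue"
  shows "integrable (lebesgue_on S) g \<longleftrightarrow> integrable lebesgue (\<lambda>x. indicator S x * g x)"
  using assms by (subst integrable_restrict_space) auto

lemma compact_sets_lebesgue: "compact K \<Longrightarrow> K \<in> sets lebesgue"
  by (intro sets_completionI_sets) (simp add: borel_compact)

lemma continuous_measurable_lebesgue:
  "continuous_on UNIV f \<Longrightarrow> f \<in> borel_measurable lebesgue"
  using continuous_imp_measurable_on_sets_lebesgue[of UNIV f] by (simp add: lebesgue_on_UNIV_eq)

lemma integrable_imp_loc_integrable:
  assumes "integrable LOm g"
  shows "loc_integrable g"
  unfolding loc_integrable_def
proof (intro allI impI, elim conjE)
  fix K assume K: "compact K" "K \<subseteq> Omega"
  have "integrable lebesgue (\<lambda>x. indicator Omega x * g x)"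
    using assms by (simp add: integrable_lebesgue_on_iff fmeasurableD)
  then have "integrable lebesgue (\<lambda>x. indicator K x *\<^sub>R (indicator Omega x * g x))"
    by (rule integrable_mult_indicator[OF compact_sets_lebesgue[OF K(1)]])
  also have "(\<lambda>x. indicator K x *\<^sub>R (indicator Omega x * g x)) = (\<lambda>x. indicator K x * g x)"
    using K(2) by (auto simp: indicator_def fun_eq_iff)
  finally show "integrable (lebesgue_on K) g"
    using compact_sets_lebesgue[OF K(1)] by (simp add: integrable_lebesgue_on_iff)
qed

lemma square_integrable_loc_integrable: "square_integrable LOm g \<Longrightarrow> loc_integrable g"
  by (intro integrable_imp_loc_integrable Omega.square_integrable_integrable)

lemma loc_integrable_diff: "loc_integrable f \<Longrightarrow> loc_integrable g \<Longrightarrow> loc_integrable (\<lambda>x. f x - g x)"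
  by (auto simp: loc_integrable_def)

lemma loc_integrable_mult_test_fun:
  assumes g: "loc_integrable g" and \<phi>: "test_fun \<phi>"
  shows "integrable LOm (\<lambda>x. g x * \<phi> x)"
proof -
  obtain K where K: "compact K" "K \<subseteq> Omega" "\<And>x. x \<notin> K \<Longrightarrow> \<phi> x = 0"
    using test_funE[OF \<phi>] by metis
  have cont: "continuous_on UNIV \<phi>"
    by (intro smooth2_continuous test_fun_smooth \<phi>)
  obtain C where C: "\<And>x. x \<in> Omega \<Longrightarrow> \<bar>\<phi> x\<bar> \<le> C"
    using continuous_bounded_Omega[OF cont] by blast
  have "(1/2, 1/2) \<in> Omega" by (simp add: Omega_def)
  then have "C \<ge> 0" using C abs_ge_zero order_trans by blast
  then have C': "\<bar>\<phi> x\<bar> \<le> C" for x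
    using C[of x] test_fun_zero[OF \<phi>, of x] by (cases "x \<in> Omega") auto
  have \<phi>m: "\<phi> \<in> borel_measurable lebesgue"
    by (rule continuous_measurable_lebesgue[OF cont])
  have gK: "integrable lebesgue (\<lambda>x. indicator K x * g x)"
    using g K by (auto simp: loc_integrable_def compact_sets_lebesgue integrable_lebesgue_on_iff[symmetric])
  have "integrable lebesgue (\<lambda>x. (indicator K x * g x) * \<phi> x)"
  proof (rule Bochner_Integration.integrable_bound)
    show "integrable lebesgue (\<lambda>x. C * (indicator K x * g x))" using gK by simp
    show "(\<lambda>x. (indicator K x * g x) * \<phi> x) \<in> borel_measurable lebesgue"
      by (rule borel_measurable_times[OF borel_measurable_integrable[OF gK] \<phi>m])
    show "AE x in lebesgue. norm (indicator K x * g x * \<phi> x) \<le> norm (C * (indicator K x * g x))"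
      using C' \<open>C \<ge> 0\<close> by (intro AE_I2) (auto simp: abs_mult mult.commute[of C] intro!: mult_left_mono)
  qed
  also have "(\<lambda>x. (indicator K x * g x) * \<phi> x) = (\<lambda>x. indicator Omega x * (g x * \<phi> x))"
    using K by (auto simp: indicator_def fun_eq_iff)
  finally show ?thesis by (simp add: integrable_lebesgue_on_iff fmeasurableD)
qed

text \<open>Tensor products of bumps are bounded by 1, vanish off the closed box and converge
  pointwise to the indicator of the open box. As \<open>k\<close> is integrable on the closed box,
  dominated convergence applies.\<close>

lemma integral_box_zero:
  assumes k: "loc_integrable k"
    and zero: "\<And>\<phi>. test_fun \<phi> \<Longrightarrow> (\<integral>x. k x * \<phi> x \<partial>LOm) = 0"
    and sub: "cbox p q \<subseteq> Omega"
  shows "(\<integral>x. indicator (box p q) x * k x \<partial>lebesgue) = 0"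
proof -
  obtain a c b d where pq: "p = (a, c)" "q = (b, d)" by (cases p, cases q)
  let ?Q = "cbox (a, c) (b, d)"
  define \<phi> where "\<phi> n x = bump n a b (fst x) * bump n c d (snd x)" for n x
  have \<phi>: "test_fun (\<phi> n)" for n
    unfolding \<phi>_def using sub pq by (intro test_fun_bump) simp
  have \<phi>_bound: "\<bar>\<phi> n x\<bar> \<le> 1" for n x
    unfolding \<phi>_def abs_mult by (intro mult_le_one) (auto simp: bump_bounds)
  have \<phi>_zero: "\<phi> n x = 0" if "x \<notin> ?Q" for n x
  proof -
    have "fst x \<notin> {a<..<b} \<or> snd x \<notin> {c<..<d}" using that by (cases x) auto
    then show ?thesis by (auto simp: \<phi>_def bump_zero)
  qed
  have \<phi>_lim: "(\<lambda>n. \<phi> n x) \<longlonglongrightarrow> indicator (box p q) x" for x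
  proof -
    have "(\<lambda>n. \<phi> n x) \<longlonglongrightarrow> indicator {a<..<b} (fst x) * indicator {c<..<d} (snd x)"
      unfolding \<phi>_def by (intro tendsto_mult bump_tendsto)
    also have "indicator {a<..<b} (fst x) * indicator {c<..<d} (snd x) = (indicator (box p q) x :: real)"
      by (cases x) (auto simp: pq box_prod indicator_def box_real)
    finally show ?thesis .
  qed
  have \<phi>m: "\<phi> n \<in> borel_measurable lebesgue" for n
    by (intro continuous_measurable_lebesgue smooth2_continuous test_fun_smooth \<phi>)
  have kQ: "integrable lebesgue (\<lambda>x. indicator ?Q x * k x)"
    using k sub pq by (auto simp: loc_integrable_def compact_sets_lebesgue integrable_lebesgue_on_iff[symmetric])
  have "(\<lambda>n. \<integral>x. (indicator ?Q x * k x) * \<phi> n x \<partial>lebesgue)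
      \<longlonglongrightarrow> (\<integral>x. (indicator ?Q x * k x) * indicator (box p q) x \<partial>lebesgue)"
  proof (rule integral_dominated_convergence[where w = "\<lambda>x. \<bar>indicator ?Q x * k x\<bar>"])
    show "(\<lambda>x. (indicator ?Q x * k x) * \<phi> n x) \<in> borel_measurable lebesgue" for n
      by (rule borel_measurable_times[OF borel_measurable_integrable[OF kQ] \<phi>m])
    show "(\<lambda>x. (indicator ?Q x * k x) * indicator (box p q) x) \<in> borel_measurable lebesgue"
      by (intro borel_measurable_times[OF borel_measurable_integrable[OF kQ]] borel_measurable_indicator) simp
    show "integrable lebesgue (\<lambda>x. \<bar>indicator ?Q x * k x\<bar>)" using kQ by (rule integrable_abs)
    show "AE x in lebesgue. (\<lambda>n. indicator ?Q x * k x * \<phi> n x)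
        \<longlonglongrightarrow> indicator ?Q x * k x * indicator (box p q) x"
      by (intro AE_I2 tendsto_mult tendsto_const \<phi>_lim)
    show "AE x in lebesgue. norm (indicator ?Q x * k x * \<phi> n x) \<le> \<bar>indicator ?Q x * k x\<bar>" for n
      using \<phi>_bound by (intro AE_I2) (auto simp: abs_mult intro!: mult_left_le)
  qed
  moreover have "(\<integral>x. (indicator ?Q x * k x) * \<phi> n x \<partial>lebesgue) = 0" for n
  proof -
    have "(\<integral>x. (indicator ?Q x * k x) * \<phi> n x \<partial>lebesgue) = (\<integral>x. indicator Omega x *\<^sub>R (k x * \<phi> n x) \<partial>lebesgue)"
      using sub pq \<phi>_zero by (intro Bochner_Integration.integral_cong) (auto simp: indicator_def)
    also have "\<dots> = (\<integral>x. k x * \<phi> n x \<partial>LOm)"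
      by (subst integral_restrict_space) (auto simp: fmeasurableD)
    finally show ?thesis using zero[OF \<phi>] by simp
  qed
  ultimately have "(\<integral>x. (indicator ?Q x * k x) * indicator (box p q) x \<partial>lebesgue) = 0"
    by (simp add: LIMSEQ_const_iff)
  also have "(\<lambda>x. (indicator ?Q x * k x) * indicator (box p q) x) = (\<lambda>x. indicator (box p q) x * k x)"
    using box_subset_cbox[of p q] by (auto simp: pq indicator_def fun_eq_iff)
  finally show ?thesis .
qed

lemma du_Bois_Reymond:
  assumes k: "loc_integrable k"
    and zero: "\<And>\<phi>. test_fun \<phi> \<Longrightarrow> (\<integral>x. k x * \<phi> x \<partial>LOm) = 0"
  shows "AE x in LOm. k x = 0"
proof -
  \<comment> \<open>Since \<open>k\<close> is only locally integrable, the square is exhausted by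
    boxes whose closures stay inside it. The open boxes for n = 0 and n = 1 are empty, which does no
    harm.\<close>
  define l u :: "nat \<Rightarrow> real \<times> real" where "l n = (1 / Suc n, 1 / Suc n)"
    and "u n = (1 - 1 / Suc n, 1 - 1 / Suc n)" for n
  have sub: "cbox (l n) (u n) \<subseteq> Omega" for n
  proof -
    have "cbox (e, e) (1 - e, 1 - e) \<subseteq> Omega" if "e > 0" for e :: real
      using that by (auto simp: Omega_def)
    then show ?thesis unfolding l_def u_def by simp
  qed
  have "AE x in lebesgue. indicator (box (l n) (u n)) x * k x = 0" for n
  proof (rule AE_zero_of_box_integrals_zero)
    have "integrable lebesgue (\<lambda>x. indicator (cbox (l n) (u n)) x * k x)"
      using k sub[of n] by (auto simp: loc_integrable_def compact_sets_lebesgue integrable_lebesgue_on_iff[symmetric])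
    then have "integrable lebesgue (\<lambda>x. indicator (box (l n) (u n)) x *\<^sub>R (indicator (cbox (l n) (u n)) x * k x))"
      by (rule integrable_mult_indicator[rotated]) simp
    also have "(\<lambda>x. indicator (box (l n) (u n)) x *\<^sub>R (indicator (cbox (l n) (u n)) x * k x))
        = (\<lambda>x. indicator (box (l n) (u n)) x * k x)"
      using box_subset_cbox[of "l n" "u n"] by (auto simp: indicator_def fun_eq_iff)
    finally show "integrable lebesgue (\<lambda>x. indicator (box (l n) (u n)) x * k x)" .
    fix a b :: "real \<times> real"
    obtain p q where pq: "box a b \<inter> box (l n) (u n) = box p q" by (simp add: box_Int_box)
    have "(\<integral>x. indicator (box a b) x * (indicator (box (l n) (u n)) x * k x) \<partial>lebesgue)
        = (\<integral>x. indicator (box p q) x * k x \<partial>lebesgue)"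
      by (intro Bochner_Integration.integral_cong) (auto simp: indicator_def pq[symmetric])
    also have "\<dots> = 0"
    \<comment> \<open>An empty open box can have a nonempty \<open>cbox\<close> outside the square;
      only for a nonempty one is \<open>cbox p q\<close> its closure.\<close>
    proof (cases "box p q = {}")
      case False
      then have "cbox p q = closure (box p q)" by (simp add: closure_box)
      also have "\<dots> \<subseteq> cbox (l n) (u n)"
        using pq box_subset_cbox[of "l n" "u n"] by (intro closure_minimal) auto
      finally show ?thesis
        using sub[of n] by (intro integral_box_zero[OF k zero]) auto
    qed simp
    finally show "(\<integral>x. indicator (box a b) x * (indicator (box (l n) (u n)) x * k x) \<partial>lebesgue) = 0" .
  qed
  then have "AE x in lebesgue. \<forall>n. indicator (box (l n) (u n)) x * k x = 0"
    unfolding AE_all_countable by blast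
  then have "AE x in lebesgue. x \<in> Omega \<longrightarrow> k x = 0"
  proof eventually_elim
    case (elim x)
    show ?case
    proof
      assume x: "x \<in> Omega"
      obtain s t where st: "x = (s, t)" by (cases x)
      have "(\<lambda>n. 1 / real (Suc n)) \<longlonglongrightarrow> 0" by (rule LIMSEQ_Suc[OF lim_1_over_n])
      moreover have "min (min s (1 - s)) (min t (1 - t)) > 0"
        using x by (auto simp: Omega_def st)
      ultimately have "\<forall>\<^sub>F n in sequentially. 1 / real (Suc n) < min (min s (1 - s)) (min t (1 - t))"
        by (rule order_tendstoD)
      then obtain n where "1 / real (Suc n) < min (min s (1 - s)) (min t (1 - t))"
        by (auto simp: eventually_sequentially)
      then have "x \<in> box (l n) (u n)"
        by (auto simp: st l_def u_def box_prod box_real)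
      with elim[rule_format, of n] show "k x = 0" by simp
    qed
  qed
  then show ?thesis
    by (subst AE_restrict_space_iff) (auto simp: fmeasurableD)
qed

lemma weak_derivative_unique_aux:
  assumes g: "loc_integrable g" "loc_integrable g'"
    and eq: "\<And>\<phi>. test_fun \<phi> \<Longrightarrow> (\<integral>x. g x * \<phi> x \<partial>LOm) = (\<integral>x. g' x * \<phi> x \<partial>LOm)"
  shows "AE x in LOm. g x = g' x"
proof -
  have "AE x in LOm. g x - g' x = 0"
  proof (rule du_Bois_Reymond[OF loc_integrable_diff[OF g]])
    fix \<phi> assume \<phi>: "test_fun \<phi>"
    show "(\<integral>x. (g x - g' x) * \<phi> x \<partial>LOm) = 0"
      using eq[OF \<phi>] loc_integrable_mult_test_fun[OF g(1) \<phi>] loc_integrable_mult_test_fun[OF g(2) \<phi>]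
      by (simp add: left_diff_distrib)
  qed
  then show ?thesis by simp
qed

text \<open>This makes the Hilbert choice in \<open>wd1\<close> harmless: every explicit weak
  derivative agrees a.e. with the chosen one.\<close>

lemma is_wd1_unique: "is_wd1 u g \<Longrightarrow> is_wd1 u g' \<Longrightarrow> AE x in LOm. g x = g' x"
  by (rule weak_derivative_unique_aux) (auto simp: is_wd1_def)

lemma is_wd2_unique: "is_wd2 u g \<Longrightarrow> is_wd2 u g' \<Longrightarrow> AE x in LOm. g x = g' x"
  by (rule weak_derivative_unique_aux) (auto simp: is_wd2_def)

lemma is_wd1_wd1: "is_wd1 u g \<Longrightarrow> is_wd1 u (wd1 u)"
  unfolding wd1_def using someI[of "is_wd1 u" g] .

lemma is_wd2_wd2: "is_wd2 u g \<Longrightarrow> is_wd2 u (wd2 u)"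
  unfolding wd2_def using someI[of "is_wd2 u" g] .

text \<open>Differences of this kind are exactly those whose norms occur in the definition of
  \<open>H1h0\<close>. The derivative \<open>g\<close> is merely locally integrable, so its product
  with \<psi> is integrable because \<psi> has compact support.\<close>

lemma is_wd_test_fun_diff:
  assumes u: "square_integrable LOm u" and \<phi>: "test_fun \<phi>"
  shows "is_wd1 u g \<Longrightarrow> is_wd1 (\<lambda>x. u x - \<phi> x) (\<lambda>x. g x - pd1 \<phi> x)"
    and "is_wd2 u g \<Longrightarrow> is_wd2 (\<lambda>x. u x - \<phi> x) (\<lambda>x. g x - pd2 \<phi> x)"
proof -
  note L = test_fun_L2[OF \<phi>]
  {
    assume g: "is_wd1 u g"
    show "is_wd1 (\<lambda>x. u x - \<phi> x) (\<lambda>x. g x - pd1 \<phi> x)"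
      unfolding is_wd1_def
    proof (intro conjI allI impI)
      fix \<psi> assume \<psi>: "test_fun \<psi>"
      note L' = test_fun_L2[OF \<psi>]
      have "(\<integral>x. (u x - \<phi> x) * pd1 \<psi> x \<partial>LOm) = (\<integral>x. u x * pd1 \<psi> x \<partial>LOm) - (\<integral>x. \<phi> x * pd1 \<psi> x \<partial>LOm)"
        using square_integrable_mult[OF u L'(2)] square_integrable_mult[OF L(1) L'(2)]
        by (simp add: left_diff_distrib)
      also have "\<dots> = - (\<integral>x. g x * \<psi> x \<partial>LOm) + (\<integral>x. pd1 \<phi> x * \<psi> x \<partial>LOm)"
        using g \<psi> test_fun_by_parts(1)[OF \<psi> test_fun_smooth[OF \<phi>]] by (simp add: is_wd1_def)
      also have "\<dots> = - (\<integral>x. (g x - pd1 \<phi> x) * \<psi> x \<partial>LOm)"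
        using loc_integrable_mult_test_fun[OF _ \<psi>, of g] g square_integrable_mult[OF L(2) L'(1)]
        by (simp add: is_wd1_def left_diff_distrib)
      finally show "(\<integral>x. (u x - \<phi> x) * pd1 \<psi> x \<partial>LOm) = - (\<integral>x. (g x - pd1 \<phi> x) * \<psi> x \<partial>LOm)" .
    qed (use g loc_integrable_diff square_integrable_loc_integrable[OF L(1)]
        square_integrable_loc_integrable[OF L(2)] in \<open>auto simp: is_wd1_def\<close>)
  }
  {
    assume g: "is_wd2 u g"
    show "is_wd2 (\<lambda>x. u x - \<phi> x) (\<lambda>x. g x - pd2 \<phi> x)"
      unfolding is_wd2_def
    proof (intro conjI allI impI)
      fix \<psi> assume \<psi>: "test_fun \<psi>"
      note L' = test_fun_L2[OF \<psi>]
      have "(\<integral>x. (u x - \<phi> x) * pd2 \<psi> x \<partial>LOm) = (\<integral>x. u x * pd2 \<psi> x \<partial>LOm) - (\<integral>x. \<phi> x * pd2 \<psi> x \<partial>LOm)"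
        using square_integrable_mult[OF u L'(3)] square_integrable_mult[OF L(1) L'(3)]
        by (simp add: left_diff_distrib)
      also have "\<dots> = - (\<integral>x. g x * \<psi> x \<partial>LOm) + (\<integral>x. pd2 \<phi> x * \<psi> x \<partial>LOm)"
        using g \<psi> test_fun_by_parts(2)[OF \<psi> test_fun_smooth[OF \<phi>]] by (simp add: is_wd2_def)
      also have "\<dots> = - (\<integral>x. (g x - pd2 \<phi> x) * \<psi> x \<partial>LOm)"
        using loc_integrable_mult_test_fun[OF _ \<psi>, of g] g square_integrable_mult[OF L(3) L'(1)]
        by (simp add: is_wd2_def left_diff_distrib)
      finally show "(\<integral>x. (u x - \<phi> x) * pd2 \<psi> x \<partial>LOm) = - (\<integral>x. (g x - pd2 \<phi> x) * \<psi> x \<partial>LOm)" .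
    qed (use g loc_integrable_diff square_integrable_loc_integrable[OF L(1)]
        square_integrable_loc_integrable[OF L(3)] in \<open>auto simp: is_wd2_def\<close>)
  }
qed

section \<open>The weighted Sobolev space\<close>

text \<open>Completeness of Lebesgue measure, applied after extension by zero. It transfers
  measurability to expressions in the chosen weak derivatives.\<close>

lemma borel_measurable_Omega_AE:
  fixes f g :: "real \<times> real \<Rightarrow> real"
  assumes f: "f \<in> borel_measurable LOm" and ae: "AE x in LOm. f x = g x"
  shows "g \<in> borel_measurable LOm"
proof -
  have "(\<lambda>x. f x * indicator Omega x) \<in> borel_measurable lebesgue"
    using f by (simp add: borel_measurable_restrict_space_iff fmeasurableD mult.commute)
  moreover have "AE x in lebesgue. f x * indicator Omega x = g x * indicator Omega x"
    using ae by (subst (asm) AE_restrict_space_iff) (auto simp: fmeasurableD elim!: eventually_mono)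
  ultimately have "(\<lambda>x. g x * indicator Omega x) \<in> borel_measurable lebesgue"
    by (rule borel_measurable_AE)
  then show ?thesis
    by (simp add: borel_measurable_restrict_space_iff fmeasurableD mult.commute)
qed

lemma square_integrable_Omega_AE:
  fixes f g :: "real \<times> real \<Rightarrow> real"
  assumes f: "square_integrable LOm f" and ae: "AE x in LOm. f x = g x"
  shows "square_integrable LOm g" "(\<integral>x. (g x)\<^sup>2 \<partial>LOm) = (\<integral>x. (f x)\<^sup>2 \<partial>LOm)"
proof -
  have m: "f \<in> borel_measurable LOm" "g \<in> borel_measurable LOm"
    using f borel_measurable_Omega_AE[OF _ ae] by (auto simp: square_integrable_def)
  have ae': "AE x in LOm. (f x)\<^sup>2 = (g x)\<^sup>2" using ae by eventually_elim simp
  show "(\<integral>x. (g x)\<^sup>2 \<partial>LOm) = (\<integral>x. (f x)\<^sup>2 \<partial>LOm)"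
    using m ae' by (intro integral_cong_AE) auto
  show "square_integrable LOm g"
    using f m integrable_cong_AE[OF _ _ ae'] by (auto simp: square_integrable_def)
qed

text \<open>A substitute for the triangle inequality that avoids square roots at the price of a
  factor 2.\<close>

lemma integral_power2_diff_le:
  assumes "square_integrable M a" "square_integrable M b"
  shows "(\<integral>x. (a x - b x)\<^sup>2 \<partial>M) \<le> 2 * (\<integral>x. (a x)\<^sup>2 \<partial>M) + 2 * (\<integral>x. (b x)\<^sup>2 \<partial>M)"
proof -
  have "(\<integral>x. (a x - b x)\<^sup>2 \<partial>M) \<le> (\<integral>x. 2 * (a x)\<^sup>2 + 2 * (b x)\<^sup>2 \<partial>M)"
  proof (rule integral_mono)
    have "(s - t)\<^sup>2 \<le> 2 * s\<^sup>2 + 2 * t\<^sup>2" for s t :: real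
      using zero_le_power2[of "s + t"] by (simp add: power2_diff power2_sum)
    then show "(a x - b x)\<^sup>2 \<le> 2 * (a x)\<^sup>2 + 2 * (b x)\<^sup>2" for x .
  qed (use assms square_integrable_diff[OF assms] in \<open>auto simp: square_integrable_power2\<close>)
  also have "\<dots> = 2 * (\<integral>x. (a x)\<^sup>2 \<partial>M) + 2 * (\<integral>x. (b x)\<^sup>2 \<partial>M)"
    using assms by (simp add: square_integrable_power2)
  finally show ?thesis .
qed

lemma L2_lim_diff:
  assumes sq: "square_integrable M a" "square_integrable M b"
      "\<And>n. square_integrable M (s n)" "\<And>n. square_integrable M (t n)"
    and lim: "(\<lambda>n. \<integral>x. (a x - s n x)\<^sup>2 \<partial>M) \<longlonglongrightarrow> 0" "(\<lambda>n. \<integral>x. (b x - t n x)\<^sup>2 \<partial>M) \<longlonglongrightarrow> 0"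
  shows "(\<lambda>n. \<integral>x. ((a x - b x) - (s n x - t n x))\<^sup>2 \<partial>M) \<longlonglongrightarrow> 0"
proof -
  have "(\<lambda>n. 2 * (\<integral>x. (a x - s n x)\<^sup>2 \<partial>M) + 2 * (\<integral>x. (b x - t n x)\<^sup>2 \<partial>M)) \<longlonglongrightarrow> 2 * 0 + 2 * 0"
    by (intro tendsto_intros lim)
  then have lim0: "(\<lambda>n. 2 * (\<integral>x. (a x - s n x)\<^sup>2 \<partial>M) + 2 * (\<integral>x. (b x - t n x)\<^sup>2 \<partial>M)) \<longlonglongrightarrow> 0" by simp
  have le: "(\<integral>x. ((a x - b x) - (s n x - t n x))\<^sup>2 \<partial>M)
      \<le> 2 * (\<integral>x. (a x - s n x)\<^sup>2 \<partial>M) + 2 * (\<integral>x. (b x - t n x)\<^sup>2 \<partial>M)" for n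
  proof -
    have eq: "(a x - b x) - (s n x - t n x) = (a x - s n x) - (b x - t n x)" for x by simp
    show ?thesis
      unfolding eq by (intro integral_power2_diff_le square_integrable_diff sq)
  qed
  show ?thesis
    by (rule tendsto_sandwich[OF _ _ tendsto_const lim0]) (use le in simp_all)
qed

locale degenerate_weight =
  fixes h :: "real \<Rightarrow> real" and H :: real
  assumes h_cont: "continuous_on {0<..<1} h"
    and h_pos: "t \<in> {0<..<1} \<Longrightarrow> 0 < h t"
    and h_le: "t \<in> {0<..<1} \<Longrightarrow> h t \<le> H"
begin

abbreviation w :: "real \<times> real \<Rightarrow> real" where
  "w x \<equiv> sqrt (h (fst x))"

lemma w_continuous: "continuous_on Omega w"
  by (auto intro!: continuous_intros continuous_on_compose2[OF h_cont] simp: Omega_def)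

lemma w_pos: "x \<in> Omega \<Longrightarrow> 0 < w x"
  using h_pos by (auto simp: Omega_def)

lemma w_square: "x \<in> Omega \<Longrightarrow> w x * w x = h (fst x)"
  using h_pos[of "fst x"] by (auto simp: Omega_def)

lemma w_measurable [measurable]: "w \<in> borel_measurable LOm"
  by (rule continuous_measurable_Omega[OF w_continuous])

lemma square_integrable_w_mult:
  "square_integrable LOm u \<Longrightarrow> square_integrable LOm (\<lambda>x. w x * u x)"
  using h_le h_pos
  by (intro square_integrable_bound_mult[where K = "sqrt H"] AE_Omega w_measurable)
    (auto simp: Omega_def less_imp_le)

text \<open>A positive continuous function attains its minimum on a compact set. The degeneration at
  x1 = 0 is thus invisible to test functions.\<close>

lemma w_bounded_below:
  assumes "compact K" "K \<subseteq> Omega"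
  obtains c where "c > 0" "\<And>x. x \<in> K \<Longrightarrow> c \<le> w x"
proof (cases "K = {}")
  case False
  have "continuous_on K w" using w_continuous assms(2) by (rule continuous_on_subset)
  then obtain z where "z \<in> K" "\<forall>x\<in>K. w z \<le> w x"
    using continuous_attains_inf[OF assms(1) False] by blast
  then show ?thesis using w_pos[of z] assms(2) by (intro that[of "w z"]) auto
qed (use that[of 1] in auto)

lemma loc_integrable_div_w:
  assumes q: "square_integrable LOm q"
  shows "loc_integrable (\<lambda>x. q x / w x)"
  unfolding loc_integrable_def
proof (intro allI impI, elim conjE)
  fix K assume K: "compact K" "K \<subseteq> Omega"
  obtain c where c: "c > 0" "\<And>x. x \<in> K \<Longrightarrow> c \<le> w x"
    using w_bounded_below[OF K] by metis
  have qK: "integrable (lebesgue_on K) q"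
    using square_integrable_loc_integrable[OF q] K by (simp add: loc_integrable_def)
  have wK: "w \<in> borel_measurable (lebesgue_on K)"
    using K by (intro continuous_imp_measurable_on_sets_lebesgue continuous_on_subset[OF w_continuous]
        compact_sets_lebesgue)
  show "integrable (lebesgue_on K) (\<lambda>x. q x / w x)"
  proof (rule Bochner_Integration.integrable_bound)
    show "integrable (lebesgue_on K) (\<lambda>x. q x / c)" using qK by simp
    show "(\<lambda>x. q x / w x) \<in> borel_measurable (lebesgue_on K)"
      using qK wK by (intro borel_measurable_divide) auto
    show "AE x in lebesgue_on K. norm (q x / w x) \<le> norm (q x / c)"
    proof (rule AE_I2)
      fix x assume "x \<in> space (lebesgue_on K)"
      then have "c \<le> \<bar>w x\<bar>" using c(2)[of x] by simp
      with c(1) show "norm (q x / w x) \<le> norm (q x / c)"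
        by (auto simp: abs_divide intro!: divide_left_mono mult_pos_pos)
    qed
  qed
qed

text \<open>The quotient is bounded: on the support \<open>w\<close> stays away from 0, and
  elsewhere the numerator vanishes. It serves as the fixed factor against which
  \<open>w * pd2\<close> of an approximating sequence is integrated.\<close>

lemma test_fun_div_w_square_integrable:
  assumes \<psi>: "test_fun \<psi>"
  shows "square_integrable LOm (\<lambda>x. \<psi> x / w x)"
proof -
  obtain K where K: "compact K" "K \<subseteq> Omega" "\<And>x. x \<notin> K \<Longrightarrow> \<psi> x = 0"
    using test_funE[OF \<psi>] by metis
  obtain c where c: "c > 0" "\<And>x. x \<in> K \<Longrightarrow> c \<le> w x"
    using w_bounded_below[OF K(1,2)] by metis
  obtain C where C: "\<And>x. x \<in> Omega \<Longrightarrow> \<bar>\<psi> x\<bar> \<le> C"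
    using continuous_bounded_Omega[OF smooth2_continuous[OF test_fun_smooth[OF \<psi>]]] by metis
  show ?thesis
  proof (rule Omega.square_integrable_bounded[where K = "C / c"])
    show "(\<lambda>x. \<psi> x / w x) \<in> borel_measurable LOm"
      using test_fun_L2(1)[OF \<psi>] by (auto simp: square_integrable_def)
    show "AE x in LOm. \<bar>\<psi> x / w x\<bar> \<le> C / c"
    proof (rule AE_Omega)
      fix x assume x: "x \<in> Omega"
      have "0 \<le> C" using C[OF x] by linarith
      show "\<bar>\<psi> x / w x\<bar> \<le> C / c"
      proof (cases "x \<in> K")
        case True
        then have "c \<le> \<bar>w x\<bar>" using c(2)[of x] by simp
        then show ?thesis
          unfolding abs_divide using C[OF x] c(1) by (intro frac_le) auto
      qed (use K(3) \<open>0 \<le> C\<close> c(1) in simp)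
    qed
  qed
qed

text \<open>\<open>p\<close> and \<open>q\<close> stand for \<open>\<partial>\<^sub>1u\<close> and \<open>\<surd>h \<partial>\<^sub>2u\<close>.\<close>
definition H_limit :: "(real \<times> real \<Rightarrow> real) \<Rightarrow> (real \<times> real \<Rightarrow> real) \<Rightarrow> (real \<times> real \<Rightarrow> real) \<Rightarrow> bool" where
  "H_limit u p q \<longleftrightarrow> square_integrable LOm u \<and> square_integrable LOm p \<and> square_integrable LOm q \<and>
    (\<exists>\<phi>. (\<forall>n. test_fun (\<phi> n)) \<and> (\<lambda>n. \<integral>x. (u x - \<phi> n x)\<^sup>2 \<partial>LOm) \<longlonglongrightarrow> 0
      \<and> (\<lambda>n. \<integral>x. (p x - pd1 (\<phi> n) x)\<^sup>2 \<partial>LOm) \<longlonglongrightarrow> 0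
      \<and> (\<lambda>n. \<integral>x. (q x - w x * pd2 (\<phi> n) x)\<^sup>2 \<partial>LOm) \<longlonglongrightarrow> 0)"

text \<open>Classical integration by parts passes to the limit. In the second variable only
  \<open>w * pd2\<close> converges, so the weight is moved across by writing
  \<open>pd2 (\<phi> n) x * \<psi> x\<close> as
  \<open>(w x * pd2 (\<phi> n) x) * (\<psi> x / w x)\<close>.\<close>

lemma H_limit_is_wd:
  assumes "H_limit u p q"
  shows "is_wd1 u p" "is_wd2 u (\<lambda>x. q x / w x)"
proof -
  from assms obtain \<phi> where u: "square_integrable LOm u" and p: "square_integrable LOm p"
    and q: "square_integrable LOm q" and \<phi>: "\<And>n. test_fun (\<phi> n)"
    and lu: "(\<lambda>n. \<integral>x. (u x - \<phi> n x)\<^sup>2 \<partial>LOm) \<longlonglongrightarrow> 0"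
    and lp: "(\<lambda>n. \<integral>x. (p x - pd1 (\<phi> n) x)\<^sup>2 \<partial>LOm) \<longlonglongrightarrow> 0"
    and lq: "(\<lambda>n. \<integral>x. (q x - w x * pd2 (\<phi> n) x)\<^sup>2 \<partial>LOm) \<longlonglongrightarrow> 0"
    unfolding H_limit_def by blast
  note L = test_fun_L2[OF \<phi>]
  show "is_wd1 u p"
    unfolding is_wd1_def
  proof (intro conjI allI impI square_integrable_loc_integrable u p)
    fix \<psi> assume \<psi>: "test_fun \<psi>"
    note L' = test_fun_L2[OF \<psi>]
    have "(\<lambda>n. \<integral>x. \<phi> n x * pd1 \<psi> x \<partial>LOm) \<longlonglongrightarrow> (\<integral>x. u x * pd1 \<psi> x \<partial>LOm)"
      by (rule tendsto_integral_mult_L2[OF L(1) u L'(2) lu])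
    moreover have "(\<lambda>n. - (\<integral>x. pd1 (\<phi> n) x * \<psi> x \<partial>LOm)) \<longlonglongrightarrow> - (\<integral>x. p x * \<psi> x \<partial>LOm)"
      by (intro tendsto_minus tendsto_integral_mult_L2[OF L(2) p L'(1) lp])
    ultimately show "(\<integral>x. u x * pd1 \<psi> x \<partial>LOm) = - (\<integral>x. p x * \<psi> x \<partial>LOm)"
      unfolding test_fun_by_parts(1)[OF \<psi> test_fun_smooth[OF \<phi>]] by (rule LIMSEQ_unique)
  qed
  show "is_wd2 u (\<lambda>x. q x / w x)"
    unfolding is_wd2_def
  proof (intro conjI allI impI square_integrable_loc_integrable[OF u] loc_integrable_div_w[OF q])
    fix \<psi> assume \<psi>: "test_fun \<psi>"
    note L' = test_fun_L2[OF \<psi>]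
    have "(\<lambda>n. \<integral>x. \<phi> n x * pd2 \<psi> x \<partial>LOm) \<longlonglongrightarrow> (\<integral>x. u x * pd2 \<psi> x \<partial>LOm)"
      by (rule tendsto_integral_mult_L2[OF L(1) u L'(3) lu])
    moreover have "(\<lambda>n. - (\<integral>x. (w x * pd2 (\<phi> n) x) * (\<psi> x / w x) \<partial>LOm)) \<longlonglongrightarrow> - (\<integral>x. q x * (\<psi> x / w x) \<partial>LOm)"
      by (intro tendsto_minus tendsto_integral_mult_L2[OF square_integrable_w_mult[OF L(3)] q
            test_fun_div_w_square_integrable[OF \<psi>] lq])
    moreover have "(\<integral>x. (w x * pd2 (\<phi> n) x) * (\<psi> x / w x) \<partial>LOm) = (\<integral>x. pd2 (\<phi> n) x * \<psi> x \<partial>LOm)" for n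
      using w_pos by (intro Bochner_Integration.integral_cong refl) fastforce
    ultimately have "(\<integral>x. u x * pd2 \<psi> x \<partial>LOm) = - (\<integral>x. q x * (\<psi> x / w x) \<partial>LOm)"
      unfolding test_fun_by_parts(2)[OF \<psi> test_fun_smooth[OF \<phi>]] by (simp add: LIMSEQ_unique)
    then show "(\<integral>x. u x * pd2 \<psi> x \<partial>LOm) = - (\<integral>x. q x / w x * \<psi> x \<partial>LOm)" by simp
  qed
qed

text \<open>By a.e. uniqueness, norms may be computed from any explicit weak derivatives.
  \<open>q\<close> and \<open>g\<close> are kept apart because \<open>g\<close> is sometimes
  \<open>q / w\<close> and sometimes a difference of \<open>wd2 u\<close> and a classical
  derivative.\<close>

lemma H1h_from_weak_derivatives:
  assumes u: "square_integrable LOm u" and p: "square_integrable LOm p"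
    and q: "square_integrable LOm q" and q_eq: "AE x in LOm. q x = w x * g x"
    and wd: "is_wd1 u p" "is_wd2 u g"
  shows "H1h h u" "AE x in LOm. p x = wd1 u x" "AE x in LOm. q x = w x * wd2 u x"
    and "H1h_norm h u = sqrt ((\<integral>x. (u x)\<^sup>2 \<partial>LOm) + (\<integral>x. (p x)\<^sup>2 \<partial>LOm) + (\<integral>x. (q x)\<^sup>2 \<partial>LOm))"
proof -
  show ae1: "AE x in LOm. p x = wd1 u x"
    by (rule is_wd1_unique[OF wd(1) is_wd1_wd1[OF wd(1)]])
  show ae2: "AE x in LOm. q x = w x * wd2 u x"
    using is_wd2_unique[OF wd(2) is_wd2_wd2[OF wd(2)]] q_eq by eventually_elim simp
  show "H1h h u"
    using u square_integrable_Omega_AE(1)[OF p ae1] square_integrable_Omega_AE(1)[OF q ae2] wd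
    by (auto simp: H1h_def L2_iff)
  show "H1h_norm h u = sqrt ((\<integral>x. (u x)\<^sup>2 \<partial>LOm) + (\<integral>x. (p x)\<^sup>2 \<partial>LOm) + (\<integral>x. (q x)\<^sup>2 \<partial>LOm))"
    unfolding H1h_norm_def square_integrable_Omega_AE(2)[OF p ae1] square_integrable_Omega_AE(2)[OF q ae2] ..
qed

lemma H_limit_test_fun: "test_fun \<phi> \<Longrightarrow> H_limit \<phi> (pd1 \<phi>) (\<lambda>x. w x * pd2 \<phi> x)"
  unfolding H_limit_def
  by (intro conjI exI[of _ "\<lambda>_. \<phi>"] test_fun_L2 square_integrable_w_mult) auto

lemma H_limit_diff:
  assumes "H_limit u p q" "H_limit u' p' q'"
  shows "H_limit (\<lambda>x. u x - u' x) (\<lambda>x. p x - p' x) (\<lambda>x. q x - q' x)"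
proof -
  from assms(1) obtain \<phi> where 1: "square_integrable LOm u" "square_integrable LOm p"
    "square_integrable LOm q" and \<phi>: "\<And>n. test_fun (\<phi> n)"
    and l: "(\<lambda>n. \<integral>x. (u x - \<phi> n x)\<^sup>2 \<partial>LOm) \<longlonglongrightarrow> 0"
      "(\<lambda>n. \<integral>x. (p x - pd1 (\<phi> n) x)\<^sup>2 \<partial>LOm) \<longlonglongrightarrow> 0"
      "(\<lambda>n. \<integral>x. (q x - w x * pd2 (\<phi> n) x)\<^sup>2 \<partial>LOm) \<longlonglongrightarrow> 0"
    unfolding H_limit_def by blast
  from assms(2) obtain \<psi> where 2: "square_integrable LOm u'" "square_integrable LOm p'"
    "square_integrable LOm q'" and \<psi>: "\<And>n. test_fun (\<psi> n)"
    and l': "(\<lambda>n. \<integral>x. (u' x - \<psi> n x)\<^sup>2 \<partial>LOm) \<longlonglongrightarrow> 0"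
      "(\<lambda>n. \<integral>x. (p' x - pd1 (\<psi> n) x)\<^sup>2 \<partial>LOm) \<longlonglongrightarrow> 0"
      "(\<lambda>n. \<integral>x. (q' x - w x * pd2 (\<psi> n) x)\<^sup>2 \<partial>LOm) \<longlonglongrightarrow> 0"
    unfolding H_limit_def by blast
  note L = test_fun_L2[OF \<phi>] and L' = test_fun_L2[OF \<psi>]
  have pd: "pd1 (\<lambda>x. \<phi> n x - \<psi> n x) = (\<lambda>x. pd1 (\<phi> n) x - pd1 (\<psi> n) x)"
    "pd2 (\<lambda>x. \<phi> n x - \<psi> n x) = (\<lambda>x. pd2 (\<phi> n) x - pd2 (\<psi> n) x)" for n
    using pd_linear[OF test_fun_smooth[OF \<phi>] test_fun_smooth[OF \<psi>], of n "-1" n] by simp_all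
  show ?thesis
    unfolding H_limit_def
  proof (intro conjI exI[of _ "\<lambda>n x. \<phi> n x - \<psi> n x"] allI test_fun_diff \<phi> \<psi> square_integrable_diff 1 2)
    show "(\<lambda>n. \<integral>x. (u x - u' x - (\<phi> n x - \<psi> n x))\<^sup>2 \<partial>LOm) \<longlonglongrightarrow> 0"
      by (rule L2_lim_diff[OF 1(1) 2(1) L(1) L'(1) l(1) l'(1)])
    show "(\<lambda>n. \<integral>x. (p x - p' x - pd1 (\<lambda>x. \<phi> n x - \<psi> n x) x)\<^sup>2 \<partial>LOm) \<longlonglongrightarrow> 0"
      unfolding pd by (rule L2_lim_diff[OF 1(2) 2(2) L(2) L'(2) l(2) l'(2)])
    show "(\<lambda>n. \<integral>x. (q x - q' x - w x * pd2 (\<lambda>x. \<phi> n x - \<psi> n x) x)\<^sup>2 \<partial>LOm) \<longlonglongrightarrow> 0"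
      unfolding pd right_diff_distrib
      by (rule L2_lim_diff[OF 1(3) 2(3) square_integrable_w_mult[OF L(3)] square_integrable_w_mult[OF L'(3)] l(3) l'(3)])
  qed
qed

lemma H_limit_H1h:
  assumes "H_limit u p q"
  shows "H1h h u" "AE x in LOm. p x = wd1 u x" "AE x in LOm. q x = w x * wd2 u x"
    and "H1h_norm h u = sqrt ((\<integral>x. (u x)\<^sup>2 \<partial>LOm) + (\<integral>x. (p x)\<^sup>2 \<partial>LOm) + (\<integral>x. (q x)\<^sup>2 \<partial>LOm))"
proof -
  have sq: "square_integrable LOm u" "square_integrable LOm p" "square_integrable LOm q"
    using assms by (auto simp: H_limit_def)
  have "AE x in LOm. q x = w x * (q x / w x)"
    using w_pos by (intro AE_Omega) fastforce
  note * = H1h_from_weak_derivatives[OF sq this H_limit_is_wd[OF assms]]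
  show "H1h h u" "AE x in LOm. p x = wd1 u x" "AE x in LOm. q x = w x * wd2 u x"
    "H1h_norm h u = sqrt ((\<integral>x. (u x)\<^sup>2 \<partial>LOm) + (\<integral>x. (p x)\<^sup>2 \<partial>LOm) + (\<integral>x. (q x)\<^sup>2 \<partial>LOm))"
    by (fact *)+
qed

lemma H_limit_H1h0:
  assumes "H_limit u p q"
  shows "H1h0 h u"
proof -
  from assms obtain \<phi> where \<phi>: "\<And>n. test_fun (\<phi> n)"
    and l: "(\<lambda>n. \<integral>x. (u x - \<phi> n x)\<^sup>2 \<partial>LOm) \<longlonglongrightarrow> 0"
      "(\<lambda>n. \<integral>x. (p x - pd1 (\<phi> n) x)\<^sup>2 \<partial>LOm) \<longlonglongrightarrow> 0"
      "(\<lambda>n. \<integral>x. (q x - w x * pd2 (\<phi> n) x)\<^sup>2 \<partial>LOm) \<longlonglongrightarrow> 0"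
    unfolding H_limit_def by blast
  have "(\<lambda>n. H1h_norm h (\<lambda>x. u x - \<phi> n x)) \<longlonglongrightarrow> sqrt (0 + 0 + 0)"
    unfolding H_limit_H1h(4)[OF H_limit_diff[OF assms H_limit_test_fun[OF \<phi>]]]
    by (intro tendsto_intros l)
  then show ?thesis
    using \<phi> H_limit_H1h(1)[OF assms] by (auto simp: H1h0_def)
qed

text \<open>Converse of \<open>H_limit_H1h0\<close>: the squared norm of u - \<phi> n is a sum of
  three nonnegative integrals, so each of them is squeezed to 0. Together the two lemmas turn
  closure in the norm into convergence of triples.\<close>

lemma H1h0_H_limit:
  assumes "H1h0 h u"
  shows "H_limit u (wd1 u) (\<lambda>x. w x * wd2 u x)"
proof -
  from assms obtain \<phi> where \<phi>: "\<And>n. test_fun (\<phi> n)"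
    and lim: "(\<lambda>n. H1h_norm h (\<lambda>x. u x - \<phi> n x)) \<longlonglongrightarrow> 0"
    and H: "H1h h u" unfolding H1h0_def by blast
  from H have sq: "square_integrable LOm u" "square_integrable LOm (wd1 u)"
      "square_integrable LOm (\<lambda>x. w x * wd2 u x)"
    and wd: "is_wd1 u (wd1 u)" "is_wd2 u (wd2 u)"
    by (auto simp: H1h_def L2_iff intro: is_wd1_wd1 is_wd2_wd2)
  note L = test_fun_L2[OF \<phi>]
  let ?a = "\<lambda>n. \<integral>x. (u x - \<phi> n x)\<^sup>2 \<partial>LOm"
  let ?b = "\<lambda>n. \<integral>x. (wd1 u x - pd1 (\<phi> n) x)\<^sup>2 \<partial>LOm"
  let ?c = "\<lambda>n. \<integral>x. (w x * wd2 u x - w x * pd2 (\<phi> n) x)\<^sup>2 \<partial>LOm"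
  have norm: "H1h_norm h (\<lambda>x. u x - \<phi> n x) = sqrt (?a n + ?b n + ?c n)" for n
    by (rule H1h_from_weak_derivatives(4)[where g = "\<lambda>x. wd2 u x - pd2 (\<phi> n) x"])
      (auto intro!: square_integrable_diff sq L square_integrable_w_mult is_wd_test_fun_diff wd \<phi>
        simp: right_diff_distrib)
  have "(\<lambda>n. (sqrt (?a n + ?b n + ?c n))\<^sup>2) \<longlonglongrightarrow> 0\<^sup>2"
    using lim unfolding norm by (intro tendsto_power)
  then have sum: "(\<lambda>n. ?a n + ?b n + ?c n) \<longlonglongrightarrow> 0" by simp
  have "?a \<longlonglongrightarrow> 0" "?b \<longlonglongrightarrow> 0" "?c \<longlonglongrightarrow> 0"
    by (rule tendsto_sandwich[OF _ _ tendsto_const sum]; simp)+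
  then show ?thesis
    unfolding H_limit_def using sq \<phi> by blast
qed

text \<open>The Poincare inequality for test functions, passed to the limit in the only case that
  uniqueness requires. The factor 16 is 2 * 4 * 2: two splittings of a square, and the Poincare
  constant in between.\<close>

lemma Poincare_zero:
  assumes "H_limit u p q" and zero: "(\<integral>x. (p x)\<^sup>2 \<partial>LOm) = 0"
  shows "AE x in LOm. u x = 0"
proof -
  from assms(1) obtain \<phi> where sq: "square_integrable LOm u" "square_integrable LOm p"
    and \<phi>: "\<And>n. test_fun (\<phi> n)"
    and l: "(\<lambda>n. \<integral>x. (u x - \<phi> n x)\<^sup>2 \<partial>LOm) \<longlonglongrightarrow> 0"
      "(\<lambda>n. \<integral>x. (p x - pd1 (\<phi> n) x)\<^sup>2 \<partial>LOm) \<longlonglongrightarrow> 0"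
    unfolding H_limit_def by blast
  note L = test_fun_L2[OF \<phi>]
  have le: "(\<integral>x. (u x)\<^sup>2 \<partial>LOm) \<le> 2 * (\<integral>x. (u x - \<phi> n x)\<^sup>2 \<partial>LOm) + 16 * (\<integral>x. (p x - pd1 (\<phi> n) x)\<^sup>2 \<partial>LOm)" for n
  proof -
    have "(\<integral>x. (\<phi> n x)\<^sup>2 \<partial>LOm) \<le> 4 * (\<integral>x. (pd1 (\<phi> n) x)\<^sup>2 \<partial>LOm)" by (rule Poincare_test_fun[OF \<phi>])
    also have "(\<integral>x. (pd1 (\<phi> n) x)\<^sup>2 \<partial>LOm) \<le> 2 * (\<integral>x. (p x - pd1 (\<phi> n) x)\<^sup>2 \<partial>LOm)"
      using integral_power2_diff_le[OF sq(2) square_integrable_diff[OF sq(2) L(2)[of n]]] zero by simp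
    finally have "(\<integral>x. (\<phi> n x)\<^sup>2 \<partial>LOm) \<le> 8 * (\<integral>x. (p x - pd1 (\<phi> n) x)\<^sup>2 \<partial>LOm)" by simp
    moreover have "(\<integral>x. (u x)\<^sup>2 \<partial>LOm) \<le> 2 * (\<integral>x. (u x - \<phi> n x)\<^sup>2 \<partial>LOm) + 2 * (\<integral>x. (\<phi> n x)\<^sup>2 \<partial>LOm)"
      using integral_power2_diff_le[OF square_integrable_diff[OF sq(1) L(1)[of n]]
          square_integrable_cmult[OF L(1)[of n], of "-1"]] by simp
    ultimately show ?thesis by simp
  qed
  have "(\<lambda>n. 2 * (\<integral>x. (u x - \<phi> n x)\<^sup>2 \<partial>LOm) + 16 * (\<integral>x. (p x - pd1 (\<phi> n) x)\<^sup>2 \<partial>LOm)) \<longlonglongrightarrow> 2 * 0 + 16 * 0"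
    by (intro tendsto_intros l)
  then have "(\<integral>x. (u x)\<^sup>2 \<partial>LOm) \<le> 2 * 0 + 16 * 0"
    by (rule LIMSEQ_le_const) (use le in blast)
  then have "(\<integral>x. (u x)\<^sup>2 \<partial>LOm) = 0" by (simp add: order.antisym)
  then show ?thesis
    using integral_nonneg_eq_0_iff_AE[OF square_integrable_power2[OF sq(1)]] by simp
qed

end

section \<open>Weak solutions\<close>

locale degenerate_problem = degenerate_weight +
  fixes V :: "real \<times> real \<Rightarrow> real" and M :: real
  assumes V_meas: "V \<in> borel_measurable LOm"
    and V_bnd: "AE x in LOm. 0 \<le> V x \<and> V x \<le> M"
begin

text \<open>The bilinear form on triples, which depends on no choice of weak derivatives and is
  therefore exactly linear. Grouping \<open>V\<close> with the second function makes each term a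
  product of two square integrable functions.\<close>

definition energy :: "(real \<times> real \<Rightarrow> real) \<Rightarrow> (real \<times> real \<Rightarrow> real) \<Rightarrow> (real \<times> real \<Rightarrow> real) \<Rightarrow>
    (real \<times> real \<Rightarrow> real) \<Rightarrow> (real \<times> real \<Rightarrow> real) \<Rightarrow> (real \<times> real \<Rightarrow> real) \<Rightarrow> real" where
  "energy u p q u' p' q' =
    (\<integral>x. p x * p' x \<partial>LOm) + (\<integral>x. q x * q' x \<partial>LOm) + (\<integral>x. u x * (V x * u' x) \<partial>LOm)"

lemma square_integrable_V_mult:
  "square_integrable LOm u \<Longrightarrow> square_integrable LOm (\<lambda>x. V x * u x)"
  using V_bnd by (intro square_integrable_bound_mult[where K = M] V_meas) (auto elim: eventually_mono)

lemma energy_sym: "energy u p q u' p' q' = energy u' p' q' u p q"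
  unfolding energy_def by (simp add: mult_ac)

lemma energy_linear:
  assumes "square_integrable LOm u" "square_integrable LOm p" "square_integrable LOm q"
    "square_integrable LOm v" "square_integrable LOm r" "square_integrable LOm s"
    "square_integrable LOm u'" "square_integrable LOm p'" "square_integrable LOm q'"
  shows "energy (\<lambda>x. u x + c * v x) (\<lambda>x. p x + c * r x) (\<lambda>x. q x + c * s x) u' p' q'
    = energy u p q u' p' q' + c * energy v r s u' p' q'"
proof -
  have lin: "(\<integral>x. (a x + c * b x) * d x \<partial>LOm) = (\<integral>x. a x * d x \<partial>LOm) + c * (\<integral>x. b x * d x \<partial>LOm)"
    if "square_integrable LOm a" "square_integrable LOm b" "square_integrable LOm d" for a b d
    using square_integrable_mult[OF that(1,3)] square_integrable_mult[OF that(2,3)]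
    by (simp add: distrib_right mult.assoc)
  show ?thesis
    unfolding energy_def using assms by (simp add: lin square_integrable_V_mult distrib_left)
qed

lemma energy_ge:
  assumes "square_integrable LOm u"
  shows "energy u p q u p q \<ge> (\<integral>x. (p x)\<^sup>2 \<partial>LOm) + (\<integral>x. (q x)\<^sup>2 \<partial>LOm)"
proof -
  have "AE x in LOm. 0 \<le> u x * (V x * u x)"
    using V_bnd by eventually_elim (simp add: mult.left_commute[of "u _"])
  then have "0 \<le> (\<integral>x. u x * (V x * u x) \<partial>LOm)" by (rule integral_nonneg_AE)
  then show ?thesis by (simp add: energy_def power2_eq_square)
qed

lemma tendsto_energy:
  assumes "square_integrable LOm u" "square_integrable LOm p" "square_integrable LOm q"
    "\<And>n. square_integrable LOm (v n)" "\<And>n. square_integrable LOm (r n)" "\<And>n. square_integrable LOm (s n)"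
    "square_integrable LOm u'" "square_integrable LOm p'" "square_integrable LOm q'"
    and lim: "(\<lambda>n. \<integral>x. (u x - v n x)\<^sup>2 \<partial>LOm) \<longlonglongrightarrow> 0" "(\<lambda>n. \<integral>x. (p x - r n x)\<^sup>2 \<partial>LOm) \<longlonglongrightarrow> 0"
      "(\<lambda>n. \<integral>x. (q x - s n x)\<^sup>2 \<partial>LOm) \<longlonglongrightarrow> 0"
  shows "(\<lambda>n. energy (v n) (r n) (s n) u' p' q') \<longlonglongrightarrow> energy u p q u' p' q'"
  unfolding energy_def using assms
  by (intro tendsto_add tendsto_integral_mult_L2 square_integrable_V_mult)

text \<open>Each of \<open>q\<close> and \<open>q'\<close> contributes one factor \<open>w\<close>
  a.e., and together they give h. Measurability of the integrand of \<open>bilin\<close> is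
  inherited from the other side through the a.e. equality.\<close>

lemma bilin_eq_energy:
  assumes H: "H_limit u p q" "H_limit u' p' q'"
  shows "bilin h V u u' = energy u p q u' p' q'"
proof -
  have sq: "square_integrable LOm u" "square_integrable LOm p" "square_integrable LOm q"
    "square_integrable LOm u'" "square_integrable LOm p'" "square_integrable LOm q'"
    using H by (auto simp: H_limit_def)
  note int = square_integrable_mult[OF sq(2,5)] square_integrable_mult[OF sq(3,6)]
    square_integrable_mult[OF sq(1) square_integrable_V_mult[OF sq(4)]]
  have w2: "AE x in LOm. w x * w x = h (fst x)" by (rule AE_Omega) (rule w_square)
  have ae: "AE x in LOm. p x * p' x + q x * q' x + u x * (V x * u' x)
      = wd1 u x * wd1 u' x + h (fst x) * wd2 u x * wd2 u' x + V x * u x * u' x"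
    using H_limit_H1h(2,3)[OF H(1)] H_limit_H1h(2,3)[OF H(2)] w2
  proof eventually_elim
    case (elim x)
    have "q x * q' x = (w x * w x) * wd2 u x * wd2 u' x"
      unfolding elim(2,4) by (simp only: mult_ac)
    then show ?case unfolding elim by (simp add: mult_ac)
  qed
  have m: "(\<lambda>x. p x * p' x + q x * q' x + u x * (V x * u' x)) \<in> borel_measurable LOm"
    using int by (intro borel_measurable_add borel_measurable_integrable)
  have "bilin h V u u' = (\<integral>x. p x * p' x + q x * q' x + u x * (V x * u' x) \<partial>LOm)"
    unfolding bilin_def
    by (rule integral_cong_AE[symmetric, OF m borel_measurable_Omega_AE[OF m ae] ae])
  also have "\<dots> = energy u p q u' p' q'"
    unfolding energy_def using int by simp
  finally show ?thesis .
qed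

text \<open>Both solutions are tested with their difference, which is admissible by
  \<open>H_limit_diff\<close>. Its triple consists of the differences of the chosen derivatives, not
  of chosen derivatives of the difference, so linearity of \<open>energy\<close> applies directly;
  zero energy then makes the x1-component null.\<close>

lemma weak_solution_unique:
  assumes "weak_solution h V f u" "weak_solution h V f v"
  shows "AE x in LOm. v x = u x"
proof -
  have Hu: "H1h0 h u" and Hv: "H1h0 h v" using assms by (auto simp: weak_solution_def)
  note lu = H1h0_H_limit[OF Hu] and lv = H1h0_H_limit[OF Hv]
  let ?d = "\<lambda>x. v x - u x" and ?p = "\<lambda>x. wd1 v x - wd1 u x" and ?q = "\<lambda>x. w x * wd2 v x - w x * wd2 u x"
  have ld: "H_limit ?d ?p ?q" by (rule H_limit_diff[OF lv lu])
  have "bilin h V v ?d = bilin h V u ?d"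
    using assms H_limit_H1h0[OF ld] by (simp add: weak_solution_def)
  then have eq: "energy v (wd1 v) (\<lambda>x. w x * wd2 v x) ?d ?p ?q = energy u (wd1 u) (\<lambda>x. w x * wd2 u x) ?d ?p ?q"
    by (simp add: bilin_eq_energy[OF lu ld] bilin_eq_energy[OF lv ld])
  have "energy ?d ?p ?q ?d ?p ?q = 0"
    using energy_linear[of v "wd1 v" "\<lambda>x. w x * wd2 v x" u "wd1 u" "\<lambda>x. w x * wd2 u x" ?d ?p ?q "-1"] lu lv ld eq
    by (simp add: H_limit_def)
  moreover have "square_integrable LOm ?d" using ld by (simp add: H_limit_def)
  ultimately have "(\<integral>x. (?p x)\<^sup>2 \<partial>LOm) + (\<integral>x. (?q x)\<^sup>2 \<partial>LOm) \<le> 0"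
    using energy_ge[of ?d ?p ?q] by simp
  moreover have "(\<integral>x. (?p x)\<^sup>2 \<partial>LOm) \<ge> 0" "(\<integral>x. (?q x)\<^sup>2 \<partial>LOm) \<ge> 0" by simp_all
  ultimately have "(\<integral>x. (?p x)\<^sup>2 \<partial>LOm) = 0" by linarith
  from Poincare_zero[OF ld this] show ?thesis by simp
qed

lemma weak_solution_exists:
  assumes f: "square_integrable LOm f"
  shows "\<exists>u. weak_solution h V f u"
proof -
  define B where "B \<phi> \<psi> = energy \<phi> (pd1 \<phi>) (\<lambda>x. w x * pd2 \<phi> x) \<psi> (pd1 \<psi>) (\<lambda>x. w x * pd2 \<psi> x)" for \<phi> \<psi>
  define F where "F \<phi> = (\<integral>x. \<phi> x * f x \<partial>LOm)" for \<phi>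
  have wL: "square_integrable LOm (\<lambda>x. w x * pd2 \<phi> x)" if "test_fun \<phi>" for \<phi>
    using that by (intro square_integrable_w_mult test_fun_L2)
  have B_ge: "(\<integral>x. (pd1 \<phi> x)\<^sup>2 \<partial>LOm) + (\<integral>x. (w x * pd2 \<phi> x)\<^sup>2 \<partial>LOm) \<le> B \<phi> \<phi>" if "test_fun \<phi>" for \<phi>
    unfolding B_def using test_fun_L2[OF that] by (intro energy_ge)
  have nn: "(\<integral>x. (a x)\<^sup>2 \<partial>LOm) \<ge> 0" for a :: "real \<times> real \<Rightarrow> real" by simp
  have B_ge1: "(\<integral>x. (pd1 \<phi> x)\<^sup>2 \<partial>LOm) \<le> B \<phi> \<phi>" and B_ge2: "(\<integral>x. (w x * pd2 \<phi> x)\<^sup>2 \<partial>LOm) \<le> B \<phi> \<phi>"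
    and B_ge3: "(\<integral>x. (\<phi> x)\<^sup>2 \<partial>LOm) \<le> 4 * B \<phi> \<phi>" if "test_fun \<phi>" for \<phi>
    using B_ge[OF that] Poincare_test_fun[OF that] nn[of "pd1 \<phi>"] nn[of "\<lambda>x. w x * pd2 \<phi> x"] by linarith+
  obtain v where v: "\<And>n. v n \<in> Collect test_fun"
    and cauchy: "\<And>m n. B (\<lambda>x. v m x - v n x) (\<lambda>x. v m x - v n x) \<le> 2 / Suc m + 2 / Suc n"
    and lim: "\<And>\<psi>. \<psi> \<in> Collect test_fun \<Longrightarrow> (\<lambda>n. B (v n) \<psi>) \<longlonglongrightarrow> F \<psi>"
  \<comment> \<open>The constant combines Cauchy-Schwarz for \<open>F\<close> with the factor 4 of
    \<open>B_ge3\<close>.\<close>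
  proof (rule Riesz_minimizing_sequence[of "Collect test_fun" B F "4 * (\<integral>x. (f x)\<^sup>2 \<partial>LOm)"])
    show "Collect test_fun \<noteq> {}" using test_fun_const_zero by blast
    show "(\<lambda>x. u x + c * v x) \<in> Collect test_fun"
      if "u \<in> Collect test_fun" "v \<in> Collect test_fun" for u v c
      using that by (simp add: test_fun_linear)
    show "B (\<lambda>x. u x + c * v x) z = B u z + c * B v z"
      if "u \<in> Collect test_fun" "v \<in> Collect test_fun" "z \<in> Collect test_fun" for u v z c
    proof -
      have t: "test_fun u" "test_fun v" "test_fun z" using that by auto
      have eq: "(\<lambda>x. w x * (pd2 u x + c * pd2 v x)) = (\<lambda>x. w x * pd2 u x + c * (w x * pd2 v x))"
        by (simp add: fun_eq_iff algebra_simps)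
      show ?thesis
        unfolding B_def pd_linear[OF t(1,2)[THEN test_fun_smooth]] eq
        using t by (intro energy_linear wL test_fun_L2)
    qed
    show "B u z = B z u" for u z unfolding B_def by (rule energy_sym)
    show "0 \<le> B u u" if "u \<in> Collect test_fun" for u
      by (rule order_trans[OF nn B_ge1]) (use that in simp)
    show "F (\<lambda>x. u x + c * z x) = F u + c * F z"
      if "u \<in> Collect test_fun" "z \<in> Collect test_fun" for u z c
      using that square_integrable_mult[OF test_fun_L2(1) f]
      by (simp add: F_def distrib_right mult.assoc)
    show "(F u)\<^sup>2 \<le> 4 * (\<integral>x. (f x)\<^sup>2 \<partial>LOm) * B u u" if "u \<in> Collect test_fun" for u
    proof -
      have "(F u)\<^sup>2 \<le> (\<integral>x. (u x)\<^sup>2 \<partial>LOm) * (\<integral>x. (f x)\<^sup>2 \<partial>LOm)"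
        unfolding F_def using that by (intro square_integrable_Cauchy_Schwarz test_fun_L2 f) simp
      also have "\<dots> \<le> (4 * B u u) * (\<integral>x. (f x)\<^sup>2 \<partial>LOm)"
        using that B_ge3[of u] by (intro mult_right_mono nn) simp
      finally show ?thesis by (simp add: mult_ac)
    qed
    fix v
    assume "\<And>n. v n \<in> Collect test_fun"
      "\<And>m n. B (\<lambda>x. v m x - v n x) (\<lambda>x. v m x - v n x) \<le> 2 / Suc m + 2 / Suc n"
      "\<And>\<psi>. \<psi> \<in> Collect test_fun \<Longrightarrow> (\<lambda>n. B (v n) \<psi>) \<longlonglongrightarrow> F \<psi>"
    then show thesis by (rule that)
  qed
  have vt: "test_fun (v n)" for n using v by simp
  note vL = test_fun_L2[OF vt]
  \<comment> \<open>The factor 4 lets one Cauchy estimate serve all three limits: \<open>B\<close>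
    dominates the two derivative terms with constant 1 and the functions themselves with constant
    4.\<close>
  have small: "\<exists>N. \<forall>m\<ge>N. \<forall>n\<ge>N. 4 * B (\<lambda>x. v m x - v n x) (\<lambda>x. v m x - v n x) \<le> e" if "e > 0" for e
  proof -
    \<comment> \<open>Beyond N each of the two fractions is at most e/8, and 4 * (e/8 + e/8) =
      e.\<close>
    obtain N :: nat where N: "16 / e < real N" using reals_Archimedean2 by blast
    show ?thesis
    proof (intro exI[of _ N] allI impI)
      fix m n assume mn: "N \<le> m" "N \<le> n"
      have *: "2 / real (Suc k) \<le> e / 8" if "N \<le> k" for k
      proof -
        have "16 / e \<le> real (Suc k)" using N that by linarith
        then show ?thesis using \<open>e > 0\<close> by (simp add: field_simps)
      qed
      show "4 * B (\<lambda>x. v m x - v n x) (\<lambda>x. v m x - v n x) \<le> e"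
        using cauchy[of m n] *[OF mn(1)] *[OF mn(2)] by linarith
    qed
  qed
  have dt: "test_fun (\<lambda>x. v m x - v n x)" for m n by (intro test_fun_diff vt)
  have dpd: "pd1 (\<lambda>x. v m x - v n x) = (\<lambda>x. pd1 (v m) x - pd1 (v n) x)"
    "pd2 (\<lambda>x. v m x - v n x) = (\<lambda>x. pd2 (v m) x - pd2 (v n) x)" for m n
    using pd_linear[OF test_fun_smooth[OF vt] test_fun_smooth[OF vt], of m "-1" n] by simp_all
  have B0: "0 \<le> B (\<lambda>x. v m x - v n x) (\<lambda>x. v m x - v n x)" for m n
    using B_ge1[OF dt, of m n] nn order_trans by blast
  obtain u where u: "square_integrable LOm u" "(\<lambda>n. \<integral>x. (u x - v n x)\<^sup>2 \<partial>LOm) \<longlonglongrightarrow> 0"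
    using Omega.L2_complete[of v, OF vL(1)] small B_ge3[OF dt] by (meson order_trans)
  have le1: "(\<integral>x. (pd1 (v m) x - pd1 (v n) x)\<^sup>2 \<partial>LOm) \<le> 4 * B (\<lambda>x. v m x - v n x) (\<lambda>x. v m x - v n x)" for m n
    using B_ge1[OF dt, of m n] B0[of m n] unfolding dpd by linarith
  obtain p where p: "square_integrable LOm p" "(\<lambda>n. \<integral>x. (p x - pd1 (v n) x)\<^sup>2 \<partial>LOm) \<longlonglongrightarrow> 0"
    using Omega.L2_complete[of "\<lambda>n. pd1 (v n)", OF vL(2)] small le1 by (meson order_trans)
  have le2: "(\<integral>x. (w x * pd2 (v m) x - w x * pd2 (v n) x)\<^sup>2 \<partial>LOm)
      \<le> 4 * B (\<lambda>x. v m x - v n x) (\<lambda>x. v m x - v n x)" for m n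
    using B_ge2[OF dt, of m n] B0[of m n] unfolding dpd right_diff_distrib by linarith
  obtain q where q: "square_integrable LOm q" "(\<lambda>n. \<integral>x. (q x - w x * pd2 (v n) x)\<^sup>2 \<partial>LOm) \<longlonglongrightarrow> 0"
    using Omega.L2_complete[of "\<lambda>n x. w x * pd2 (v n) x", OF wL[OF vt]] small le2 by (meson order_trans)
  have lim_u: "H_limit u p q"
    unfolding H_limit_def using u p q vt by blast
  have test_eq: "energy u p q \<psi> (pd1 \<psi>) (\<lambda>x. w x * pd2 \<psi> x) = F \<psi>" if \<psi>: "test_fun \<psi>" for \<psi>
  proof (rule LIMSEQ_unique)
    show "(\<lambda>n. B (v n) \<psi>) \<longlonglongrightarrow> F \<psi>" using lim \<psi> by simp
    show "(\<lambda>n. B (v n) \<psi>) \<longlonglongrightarrow> energy u p q \<psi> (pd1 \<psi>) (\<lambda>x. w x * pd2 \<psi> x)"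
      unfolding B_def
      by (rule tendsto_energy[OF u(1) p(1) q(1) vL(1) vL(2) wL[OF vt] test_fun_L2(1,2)[OF \<psi>] wL[OF \<psi>] u(2) p(2) q(2)])
  qed
  have "bilin h V u z = (\<integral>x. f x * z x \<partial>LOm)" if "H1h0 h z" for z
  proof -
    note lz = H1h0_H_limit[OF that]
    then obtain \<phi> where z: "square_integrable LOm z" "square_integrable LOm (wd1 z)"
      "square_integrable LOm (\<lambda>x. w x * wd2 z x)" and \<phi>: "\<And>n. test_fun (\<phi> n)"
      and l: "(\<lambda>n. \<integral>x. (z x - \<phi> n x)\<^sup>2 \<partial>LOm) \<longlonglongrightarrow> 0"
        "(\<lambda>n. \<integral>x. (wd1 z x - pd1 (\<phi> n) x)\<^sup>2 \<partial>LOm) \<longlonglongrightarrow> 0"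
        "(\<lambda>n. \<integral>x. (w x * wd2 z x - w x * pd2 (\<phi> n) x)\<^sup>2 \<partial>LOm) \<longlonglongrightarrow> 0"
      unfolding H_limit_def by blast
    note L = test_fun_L2[OF \<phi>]
    \<comment> \<open>Density extends the equation from test functions to all of
      \<open>H1h0\<close>. The approximants stand in the first slot, where
      \<open>tendsto_energy\<close> applies; symmetry of \<open>energy\<close> then restores the
      order.\<close>
    have "(\<lambda>n. energy (\<phi> n) (pd1 (\<phi> n)) (\<lambda>x. w x * pd2 (\<phi> n) x) u p q)
        \<longlonglongrightarrow> energy z (wd1 z) (\<lambda>x. w x * wd2 z x) u p q"
      by (rule tendsto_energy[OF z L(1) L(2) wL[OF \<phi>] u(1) p(1) q(1) l])
    then have "(\<lambda>n. F (\<phi> n)) \<longlonglongrightarrow> energy u p q z (wd1 z) (\<lambda>x. w x * wd2 z x)"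
      unfolding energy_sym[of _ _ _ u p q] test_eq[OF \<phi>] .
    moreover have "(\<lambda>n. F (\<phi> n)) \<longlonglongrightarrow> F z"
      unfolding F_def by (rule tendsto_integral_mult_L2[OF L(1) z(1) f l(1)])
    ultimately have "energy u p q z (wd1 z) (\<lambda>x. w x * wd2 z x) = F z" by (rule LIMSEQ_unique)
    then show ?thesis
      by (simp add: bilin_eq_energy[OF lim_u lz] F_def mult.commute)
  qed
  then show ?thesis
    using H_limit_H1h0[OF lim_u] by (auto simp: weak_solution_def)
qed

end

theorem theorem4p2:
  fixes h :: "real \<Rightarrow> real" and V f :: "real \<times> real \<Rightarrow> real"
    and C \<theta> m M :: real
  assumes h_bdd: "bounded (h ` {0..1})"
    and h0: "h 0 = 0"
    and h_pos: "\<forall>t\<in>{0<..1}. h t > 0"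
    and h_C1: "\<exists>h'. (\<forall>t\<in>{0<..1}. (h has_real_derivative h' t) (at t within {0<..1}))
                     \<and> continuous_on {0<..1} h'"
    and C_pos: "C > 0" and \<theta>: "0 < \<theta>" "\<theta> < 1"
    and h_cond: "\<forall>x\<in>Omega. \<forall>r. 0 < r \<and> r \<le> diameter Omega \<longrightarrow>
        (\<integral>\<^sup>+ y. ennreal (1 / h (fst y)) * indicator (ball x r \<inter> Omega) y \<partial>lebesgue)
          \<le> ennreal (C * measure lebesgue (ball x r \<inter> Omega) powr \<theta>)"
    and V_meas: "V \<in> borel_measurable (lebesgue_on Omega)"
    and mM: "0 \<le> m" "0 \<le> M"
    and V_bnd: "AE x in lebesgue_on Omega. m \<le> V x \<and> V x \<le> M"
    and f: "L2 f"
  shows "\<exists>u. weak_solution h V f u \<and>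
           (\<forall>w. weak_solution h V f w \<longrightarrow> (AE x in lebesgue_on Omega. w x = u x))"
proof -
  obtain H where H: "\<forall>t\<in>{0..1}. \<bar>h t\<bar> \<le> H"
    using h_bdd by (auto simp: bounded_iff)
  have "continuous_on {0<..1} h"
    using h_C1 by (meson DERIV_continuous_on)
  then have cont: "continuous_on {0<..<1} h" by (rule continuous_on_subset) auto
  have V: "AE x in LOm. 0 \<le> V x \<and> V x \<le> M"
    using V_bnd by eventually_elim (use mM(1) in linarith)
  interpret degenerate_problem h H V M
    using cont h_pos H V_meas V by unfold_locales (auto dest: bspec simp: abs_le_iff)
  show ?thesis
    using weak_solution_exists weak_solution_unique f by (meson L2_iff)
qed

end
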